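(* For all $0<T<\infty$ and all $0\le t\le T$, the zero-coupon bond price $P(t,T)=E^Q\left[e^{-\int_t^T r(s)ds}\,\middle|\,\mathcal{F}_t\right]$ satisfies \[ P(t,T)=F(t,r(t),u(t);T), \] where \[ F(t,x,y;T):=\exp\left\{-A(t,T)-C(t,T)x+D(t,T)y\right\}\qquad((t,x,y)\in[0,T]\times\mathbb{R}\times\mathbb{R}), \] with deterministic functions \[ C(t,T):=\frac{1-e^{-b(T-t)}}{b},\qquad D(t,T):=\frac{\sigma}{b}e^{-(p+q)t}m(T-t), \] \[ A(t,T):=\frac{a}{b}\left\{T-t-C(t,T)\right\}-\frac{\sigma^2}{2b^2}\int_0^{T-t}\left\{m(s)+e^{-bs}-1\right\}^2ds-\frac{\sigma^2 q\, m^2(T-t)}{b^2\{(p+2q)^2e^{2qt}-p^2\}}. \]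
   Context: Let $\{W^*(t)\}_{t\ge 0}$ be a one-dimensional standard Brownian motion on a complete probability space $(\Omega,\mathcal{F},Q)$ and let $\{\mathcal{F}_t\}_{t\ge 0}$ be the $Q$-augmentation of the filtration it generates. Let $p,q$ be real numbers with $0<q<\infty$ and $-q<p<\infty$. Define \[ l(\tau)=1-\frac{2qp}{(p+2q)^2e^{2q\tau}-p^2}\quad(\tau\ge 0), \] \[ Z(t)=W^*(t)-\int_0^t\left\{\int_0^s pe^{-(p+q)(s-\tau)}l(\tau)\,dW^*(\tau)\right\}ds\quad(t\ge 0). \] $Z$ is an It\^o process. Let $a,b,\sigma\in(0,\infty)$ and let $\{r(t)\}_{t\ge 0}$ (the short rate) be the unique strong solution of $dr(t)=\{a-br(t)\}dt+\sigma\,dZ(t)$, $t\ge 0$, with deterministic initial value $r(0)\in[0,\infty)$. $E^Q$ denotes expectation under $Q$. Further notation: $m(t):=\int_0^t pe^{-(p+q)s}\{1-e^{-b(t-s)}\}ds$ and $u(t):=\int_0^t e^{(p+q)s}l(s)\,dW^*(s)$ for $t\ge 0$. *)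

theory Defs
  imports "HOL-Probability.Probability"
begin

text \<open>Time is \<^typ>\<open>real\<close>; a stochastic process is a function \<open>X :: real \<Rightarrow> 'a \<Rightarrow> real\<close> of which only
  the values at nonnegative times are ever used.\<close>


section \<open>Brownian motion and its augmented filtration\<close>

definition natural_filtration :: "'a measure \<Rightarrow> (real \<Rightarrow> 'a \<Rightarrow> real) \<Rightarrow> real \<Rightarrow> 'a measure" where
  "natural_filtration M X t =
     sigma (space M) {X s -` B \<inter> space M | s B. 0 \<le> s \<and> s \<le> t \<and> B \<in> sets borel}"

text \<open>The augmentation adjoins all null sets of the underlying space; it is applied to complete
  spaces, where these include all subsets of null sets.\<close>

definition augmented_filtration :: "'a measure \<Rightarrow> (real \<Rightarrow> 'a \<Rightarrow> real) \<Rightarrow> real \<Rightarrow> 'a measure" where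
  "augmented_filtration M X t =
     sigma (space M) (sets (natural_filtration M X t) \<union> null_sets M)"

definition brownian_motion :: "'a measure \<Rightarrow> (real \<Rightarrow> 'a \<Rightarrow> real) \<Rightarrow> bool" where
  "brownian_motion M W \<longleftrightarrow>
     (\<forall>t\<ge>0. W t \<in> borel_measurable M) \<and>
     (AE \<omega> in M. W 0 \<omega> = 0) \<and>
     (AE \<omega> in M. continuous_on {0..} (\<lambda>t. W t \<omega>)) \<and>
     (\<forall>s t. 0 \<le> s \<and> s < t \<longrightarrow>
        distributed M lborel (\<lambda>\<omega>. W t \<omega> - W s \<omega>) (normal_density 0 (sqrt (t - s))) \<and>
        prob_space.indep_set M
          (sets (vimage_algebra (space M) (\<lambda>\<omega>. W t \<omega> - W s \<omega>) borel))
          (sets (natural_filtration M W s)))"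

lemma natural_filtration_generator:
  "{X s -` B \<inter> space M | s B. 0 \<le> s \<and> s \<le> t \<and> B \<in> sets borel} \<subseteq> Pow (space M)"
  by auto

lemma space_natural_filtration [simp]: "space (natural_filtration M X t) = space M"
  by (simp add: natural_filtration_def space_measure_of_conv)

lemma space_augmented_filtration [simp]: "space (augmented_filtration M X t) = space M"
  by (simp add: augmented_filtration_def space_measure_of_conv)

lemma sets_natural_filtration:
  "sets (natural_filtration M X t) =
     sigma_sets (space M) {X s -` B \<inter> space M | s B. 0 \<le> s \<and> s \<le> t \<and> B \<in> sets borel}"
  unfolding natural_filtration_def using natural_filtration_generator
  by (rule sets_measure_of)

lemma sets_augmented_filtration:
  "sets (augmented_filtration M X t) =
     sigma_sets (space M) (sets (natural_filtration M X t) \<union> null_sets M)"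
proof -
  have "sets (natural_filtration M X t) \<union> null_sets M \<subseteq> Pow (space M)"
    using sets.space_closed[of "natural_filtration M X t"] sets.space_closed[of M]
    by (auto simp: null_sets_def)
  then show ?thesis
    unfolding augmented_filtration_def by (rule sets_measure_of)
qed

lemma filtration_augmented_filtration: "filtration (space M) (augmented_filtration M X)"
proof
  fix s t :: real assume "s \<le> t"
  then have "sets (natural_filtration M X s) \<subseteq> sets (natural_filtration M X t)"
    unfolding sets_natural_filtration by (intro sigma_sets_mono') fastforce
  then show "sets (augmented_filtration M X s) \<subseteq> sets (augmented_filtration M X t)"
    unfolding sets_augmented_filtration by (intro sigma_sets_mono') auto
qed simp

lemma subalgebra_augmented_filtration:
  assumes "\<And>s. 0 \<le> s \<Longrightarrow> X s \<in> borel_measurable M"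
  shows "subalgebra M (augmented_filtration M X t)"
proof -
  have "sets (natural_filtration M X t) \<subseteq> sets M"
    unfolding sets_natural_filtration
    by (rule sets.sigma_sets_subset) (auto intro!: measurable_sets[OF assms])
  then have "sets (augmented_filtration M X t) \<subseteq> sets M"
    unfolding sets_augmented_filtration
    by (intro sets.sigma_sets_subset) (auto simp: null_sets_def)
  then show ?thesis
    by (simp add: subalgebra_def)
qed


section \<open>The Ito integral\<close>

text \<open>A simple integrand is \<open>\<Sum>i<n. \<xi> i \<omega> * 1\<^bsub>(ts i, ts (i+1)]\<^esub>(s)\<close>, with \<open>\<xi> i\<close> bounded
  and measurable with respect to the information at the left end point \<open>ts i\<close>.\<close>

definition simple_integrand ::
  "'a measure \<Rightarrow> (real \<Rightarrow> 'a measure) \<Rightarrow> nat \<Rightarrow> (nat \<Rightarrow> real) \<Rightarrow> (nat \<Rightarrow> 'a \<Rightarrow> real) \<Rightarrow> bool" where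
  "simple_integrand M F n ts \<xi> \<longleftrightarrow>
     0 \<le> ts 0 \<and> (\<forall>i<n. ts i < ts (Suc i)) \<and>
     (\<forall>i<n. \<xi> i \<in> borel_measurable (F (ts i)) \<and> bounded (\<xi> i ` space M))"

definition simple_process ::
  "nat \<Rightarrow> (nat \<Rightarrow> real) \<Rightarrow> (nat \<Rightarrow> 'a \<Rightarrow> real) \<Rightarrow> real \<Rightarrow> 'a \<Rightarrow> real" where
  "simple_process n ts \<xi> s \<omega> = (\<Sum>i<n. \<xi> i \<omega> * indicator {ts i<..ts (Suc i)} s)"

definition simple_integral ::
  "(real \<Rightarrow> 'a \<Rightarrow> real) \<Rightarrow> nat \<Rightarrow> (nat \<Rightarrow> real) \<Rightarrow> (nat \<Rightarrow> 'a \<Rightarrow> real) \<Rightarrow> real \<Rightarrow> 'a \<Rightarrow> real" where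
  "simple_integral W n ts \<xi> t \<omega> =
     (\<Sum>i<n. \<xi> i \<omega> * (W (min (ts (Suc i)) t) \<omega> - W (min (ts i) t) \<omega>))"

text \<open>\<open>is_ito_integral M F W t f X\<close>: the random variable \<open>X\<close> is (a version of) the Ito integral
  of the square-integrable adapted process \<open>f\<close> against \<open>W\<close> over \<open>[0, t]\<close>, i.e. the
  \<open>L\<^sup>2\<close>-limit of the elementary integrals of simple integrands approximating \<open>f\<close> in
  \<open>L\<^sup>2([0, t] \<times> \<Omega>)\<close>. This determines \<open>X\<close> up to a null set, so it is a relation.\<close>

definition is_ito_integral ::
  "'a measure \<Rightarrow> (real \<Rightarrow> 'a measure) \<Rightarrow> (real \<Rightarrow> 'a \<Rightarrow> real) \<Rightarrow> real \<Rightarrow> (real \<Rightarrow> 'a \<Rightarrow> real) \<Rightarrow>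
     ('a \<Rightarrow> real) \<Rightarrow> bool" where
  "is_ito_integral M F W t f X \<longleftrightarrow>
     (\<lambda>(s, \<omega>). f s \<omega>) \<in> borel_measurable (restrict_space borel {0..t} \<Otimes>\<^sub>M M) \<and>
     (\<forall>s\<in>{0..t}. f s \<in> borel_measurable (F s)) \<and>
     (\<integral>\<^sup>+\<omega>. (\<integral>\<^sup>+s\<in>{0..t}. ennreal ((f s \<omega>)\<^sup>2) \<partial>lborel) \<partial>M) < \<infinity> \<and>
     X \<in> borel_measurable M \<and>
     (\<exists>n ts \<xi>.
        (\<forall>k::nat. simple_integrand M F (n k) (ts k) (\<xi> k)) \<and>
        (\<lambda>k. \<integral>\<^sup>+\<omega>. (\<integral>\<^sup>+s\<in>{0..t}.
           ennreal ((simple_process (n k) (ts k) (\<xi> k) s \<omega> - f s \<omega>)\<^sup>2) \<partial>lborel) \<partial>M)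
          \<longlonglongrightarrow> 0 \<and>
        (\<lambda>k. \<integral>\<^sup>+\<omega>. ennreal ((simple_integral W (n k) (ts k) (\<xi> k) t \<omega> - X \<omega>)\<^sup>2) \<partial>M)
          \<longlonglongrightarrow> 0)"


section \<open>The driving noise and the short rate\<close>

definition l_fun :: "real \<Rightarrow> real \<Rightarrow> real \<Rightarrow> real" where
  "l_fun p q \<tau> = 1 - 2 * q * p / ((p + 2 * q)\<^sup>2 * exp (2 * q * \<tau>) - p\<^sup>2)"

text \<open>\<open>J s\<close> is the inner stochastic integral over \<open>[0, s]\<close>, whose integrand depends on \<open>s\<close>.
  Each \<open>J s\<close> is determined only up to a null set, so a jointly measurable choice is needed for
  the outer, pathwise Lebesgue integral to be meaningful; by Fubini, that integral does not
  depend on the choice up to indistinguishability.\<close>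

definition driving_process ::
  "'a measure \<Rightarrow> (real \<Rightarrow> 'a \<Rightarrow> real) \<Rightarrow> real \<Rightarrow> real \<Rightarrow> (real \<Rightarrow> 'a \<Rightarrow> real) \<Rightarrow> bool" where
  "driving_process M W p q Z \<longleftrightarrow>
     (\<exists>J.
        (\<lambda>(s, \<omega>). J s \<omega>) \<in> borel_measurable (restrict_space borel {0..} \<Otimes>\<^sub>M M) \<and>
        (\<forall>s\<ge>0. is_ito_integral M (augmented_filtration M W) W s
           (\<lambda>\<tau> \<omega>. p * exp (- (p + q) * (s - \<tau>)) * l_fun p q \<tau>) (J s)) \<and>
        (AE \<omega> in M. \<forall>t\<ge>0. Z t \<omega> = W t \<omega> - (LBINT s:{0..t}. J s \<omega>)))"

text \<open>Strong solution of \<open>dr = (a - b r) dt + \<sigma> dZ\<close>, \<open>r(0) = r0\<close>. As \<open>\<sigma>\<close> is constant,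
  its integral against the Ito process \<open>Z\<close> is \<open>\<sigma> (Z(t) - Z(0))\<close>.\<close>

definition short_rate_solution ::
  "'a measure \<Rightarrow> (real \<Rightarrow> 'a measure) \<Rightarrow> (real \<Rightarrow> 'a \<Rightarrow> real) \<Rightarrow> real \<Rightarrow> real \<Rightarrow> real \<Rightarrow> real \<Rightarrow>
     (real \<Rightarrow> 'a \<Rightarrow> real) \<Rightarrow> bool" where
  "short_rate_solution M F Z a b \<sigma> r0 r \<longleftrightarrow>
     (\<forall>t\<ge>0. r t \<in> borel_measurable (F t)) \<and>
     (AE \<omega> in M. continuous_on {0..} (\<lambda>t. r t \<omega>)) \<and>
     (AE \<omega> in M. r 0 \<omega> = r0) \<and>
     (AE \<omega> in M. \<forall>t\<ge>0.
        r t \<omega> = r 0 \<omega> + (LBINT s:{0..t}. a - b * r s \<omega>) + \<sigma> * (Z t \<omega> - Z 0 \<omega>))"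


section \<open>Bond price and its deterministic coefficients\<close>

definition discount :: "(real \<Rightarrow> 'a \<Rightarrow> real) \<Rightarrow> real \<Rightarrow> real \<Rightarrow> 'a \<Rightarrow> real" where
  "discount r t T \<omega> = exp (- (LBINT s:{t..T}. r s \<omega>))"

definition bond_price ::
  "'a measure \<Rightarrow> (real \<Rightarrow> 'a measure) \<Rightarrow> (real \<Rightarrow> 'a \<Rightarrow> real) \<Rightarrow> real \<Rightarrow> real \<Rightarrow> 'a \<Rightarrow> real" where
  "bond_price M F r t T = real_cond_exp M (F t) (discount r t T)"

definition m_fun :: "real \<Rightarrow> real \<Rightarrow> real \<Rightarrow> real \<Rightarrow> real" where
  "m_fun p q b t = (LBINT s:{0..t}. p * exp (- (p + q) * s) * (1 - exp (- b * (t - s))))"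

definition C_fun :: "real \<Rightarrow> real \<Rightarrow> real \<Rightarrow> real" where
  "C_fun b t T = (1 - exp (- b * (T - t))) / b"

definition D_fun :: "real \<Rightarrow> real \<Rightarrow> real \<Rightarrow> real \<Rightarrow> real \<Rightarrow> real \<Rightarrow> real" where
  "D_fun p q b \<sigma> t T = \<sigma> / b * exp (- (p + q) * t) * m_fun p q b (T - t)"

definition A_fun :: "real \<Rightarrow> real \<Rightarrow> real \<Rightarrow> real \<Rightarrow> real \<Rightarrow> real \<Rightarrow> real \<Rightarrow> real" where
  "A_fun p q a b \<sigma> t T =
     a / b * (T - t - C_fun b t T)
     - \<sigma>\<^sup>2 / (2 * b\<^sup>2) * (LBINT s:{0..T - t}. (m_fun p q b s + exp (- b * s) - 1)\<^sup>2)
     - \<sigma>\<^sup>2 * q * (m_fun p q b (T - t))\<^sup>2 / (b\<^sup>2 * ((p + 2 * q)\<^sup>2 * exp (2 * q * t) - p\<^sup>2))"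

definition F_fun ::
  "real \<Rightarrow> real \<Rightarrow> real \<Rightarrow> real \<Rightarrow> real \<Rightarrow> real \<Rightarrow> real \<Rightarrow> real \<Rightarrow> real \<Rightarrow> real" where
  "F_fun p q a b \<sigma> t x y T =
     exp (- A_fun p q a b \<sigma> t T - C_fun b t T * x + D_fun p q b \<sigma> t T * y)"

end

theory Submission
  imports Defs
begin

text \<open>
  The bond price is an exponential of a Gaussian integral, and the proof keeps stochastic calculus to
  a minimum: every stochastic integral involved has a continuously differentiable deterministic
  integrand \<open>g\<close>, so for a continuous path \<open>w\<close> it can be read as the number
  \<open>g t * w t - g s * w s - \<integral> g' * w\<close> (\<open>parts_integral\<close>; \<open>wiener\<close> along Brownian paths). All identities
  between such integrals then follow from the fundamental theorem of calculus, path by path.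

  \<^emph>\<open>Law.\<close> The characteristic functions of the Riemann sums of \<open>\<integral> g dW\<close>, restricted to an event of
  \<open>F s\<close>, pass to the limit and show that \<open>\<integral> g dW\<close> over \<open>[s, t]\<close> is independent of \<open>F s\<close> with the
  centred Gaussian law of variance \<open>\<integral> g\<^sup>2\<close> (\<open>prob_wiener_on_event\<close>).

  \<^emph>\<open>Identification.\<close> By the isometry \<open>ito_isometry\<close>, the elementary integrals of any simple
  integrands approximating \<open>g\<close> converge to \<open>\<integral> g dW\<close> in mean square; hence any version of the Ito
  integral of \<open>g\<close> equals it almost surely (\<open>ito_integral_deterministic\<close>). Fubini's theorem
  extends this to the inner integrals of the driving noise, simultaneously for almost all times
  (\<open>driving_process_pathwise\<close>): with \<open>k s = p * exp (- (p + q) * s)\<close> and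
  \<open>h s = exp ((p + q) * s) * l_fun p q s\<close>, almost surely \<open>Z t = W t - \<integral>\<^bsub>0\<^esub>\<^bsup>t\<^esup> k s * u s ds\<close> where
  \<open>u s\<close> is the integral of \<open>h\<close> against \<open>W\<close>.

  \<^emph>\<open>Linear functionals of the rate.\<close> The functions \<open>r - \<sigma> * W\<close> and \<open>u - h * W\<close> are continuously
  differentiable, and pairing them with weights \<open>c\<close> and \<open>- \<sigma> * G\<close>, where \<open>G' = - c * k\<close>, eliminates
  \<open>u\<close> from the derivative (\<open>short_rate_functional\<close>). For \<open>c = C_fun b _ T\<close> and
  \<open>G s = exp (- (p + q) * s) * m_fun p q b (T - s) / b\<close>, both of which vanish at \<open>T\<close>, this gives
  \<open>- \<integral>\<^bsub>t\<^esub>\<^bsup>T\<^esup> r = - a * \<integral>\<^bsub>t\<^esub>\<^bsup>T\<^esup> C - C t * r t + \<sigma> * G t * u t - \<sigma> * \<integral>\<^bsub>t\<^esub>\<^bsup>T\<^esup> (C - G * h) dW\<close>.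

  \<^emph>\<open>Conditioning.\<close> Here \<open>r t\<close> and \<open>u t\<close> are known at time \<open>t\<close>, while the last integral is independent
  of \<open>F t\<close>; its exponential therefore contributes the constant
  \<open>exp (\<sigma>\<^sup>2 / 2 * \<integral>\<^bsub>t\<^esub>\<^bsup>T\<^esup> (C - G * h)\<^sup>2)\<close>. An explicit antiderivative turns the variance into the two
  terms found in \<open>A_fun\<close> (\<open>variance_identity\<close>).
\<close>

section \<open>Integration by parts against a continuous path\<close>

text \<open>The derivative is carried as an explicit argument because it enters integration by parts, and
  it is one-sided at the end points of an interval because the integrands below are only considered at
  times between zero and the maturity.\<close>
definition C1_on :: "(real \<Rightarrow> real) \<Rightarrow> (real \<Rightarrow> real) \<Rightarrow> real set \<Rightarrow> bool" where
  "C1_on g g' S \<longleftrightarrow> (\<forall>x\<in>S. (g has_real_derivative g' x) (at x within S)) \<and> continuous_on S g'"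

text \<open>The Riemann--Stieltjes integral of \<open>g\<close> against \<open>w\<close> over \<open>[s, t]\<close>, which makes sense for every
  continuous path \<open>w\<close>, however rough, since \<open>g\<close> is differentiable.\<close>
definition parts_integral ::
  "(real \<Rightarrow> real) \<Rightarrow> (real \<Rightarrow> real) \<Rightarrow> (real \<Rightarrow> real) \<Rightarrow> real \<Rightarrow> real \<Rightarrow> real" where
  "parts_integral g g' w s t = g t * w t - g s * w s - integral {s..t} (\<lambda>x. g' x * w x)"

lemma C1_on_subset: "C1_on g g' S \<Longrightarrow> R \<subseteq> S \<Longrightarrow> C1_on g g' R"
  unfolding C1_on_def by (meson continuous_on_subset has_field_derivative_subset subsetD)

lemma C1_onD: "C1_on g g' S \<Longrightarrow> x \<in> S \<Longrightarrow> (g has_real_derivative g' x) (at x within S)"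
  by (simp add: C1_on_def)

lemma C1_on_continuous: "C1_on g g' S \<Longrightarrow> continuous_on S g"
  unfolding C1_on_def by (meson DERIV_continuous_on)

lemma C1_on_continuous_deriv: "C1_on g g' S \<Longrightarrow> continuous_on S g'"
  by (simp add: C1_on_def)

lemma C1_on_const: "C1_on (\<lambda>x. c) (\<lambda>x. 0) S"
  unfolding C1_on_def by auto

lemma C1_on_add:
  "C1_on f f' S \<Longrightarrow> C1_on g g' S \<Longrightarrow> C1_on (\<lambda>x. f x + g x) (\<lambda>x. f' x + g' x) S"
  unfolding C1_on_def by (auto intro!: derivative_intros continuous_intros)

lemma C1_on_diff:
  "C1_on f f' S \<Longrightarrow> C1_on g g' S \<Longrightarrow> C1_on (\<lambda>x. f x - g x) (\<lambda>x. f' x - g' x) S"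
  unfolding C1_on_def by (auto intro!: derivative_intros continuous_intros)

lemma C1_on_mult:
  assumes f: "C1_on f f' S" and g: "C1_on g g' S"
  shows "C1_on (\<lambda>x. f x * g x) (\<lambda>x. f' x * g x + f x * g' x) S"
proof -
  have "continuous_on S f" "continuous_on S g" using f g by (auto dest: C1_on_continuous)
  with f g show ?thesis
    unfolding C1_on_def by (auto intro!: derivative_eq_intros continuous_intros)
qed

lemma C1_on_cmult: "C1_on g g' S \<Longrightarrow> C1_on (\<lambda>x. c * g x) (\<lambda>x. c * g' x) S"
  unfolding C1_on_def by (auto intro!: derivative_eq_intros continuous_intros)

lemma C1_on_cong:
  assumes "C1_on f f' S" "\<And>x. x \<in> S \<Longrightarrow> f x = g x" "\<And>x. x \<in> S \<Longrightarrow> f' x = g' x"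
  shows "C1_on g g' S"
  unfolding C1_on_def
proof (intro conjI ballI)
  fix x assume x: "x \<in> S"
  show "(g has_real_derivative g' x) (at x within S)"
    using has_field_derivative_transform_within[OF C1_onD[OF assms(1) x] zero_less_one x] assms x by auto
next
  show "continuous_on S g'"
    using C1_on_continuous_deriv[OF assms(1)] assms(3) by (simp cong: continuous_on_cong_simp)
qed

lemma C1_on_integral:
  assumes "continuous_on {s..t} f"
  shows "C1_on (\<lambda>x. integral {s..x} f) f {s..t}"
  using assms unfolding C1_on_def by (auto intro: integral_has_real_derivative)

text \<open>Coefficients of the bond price depend on the time to maturity; this converts their derivatives
  into derivatives in calendar time.\<close>
lemma C1_on_reflect:
  assumes f: "C1_on f f' {0..T}" and "0 \<le> t"
  shows "C1_on (\<lambda>x. f (T - x)) (\<lambda>x. - f' (T - x)) {t..T}"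
proof -
  have sub: "(\<lambda>x. T - x) ` {t..T} \<subseteq> {0..T}" using \<open>0 \<le> t\<close> by auto
  have "((\<lambda>x. f (T - x)) has_real_derivative - f' (T - x)) (at x within {t..T})" if "x \<in> {t..T}" for x
  proof -
    have 1: "(f has_real_derivative f' (T - x)) (at (T - x) within (\<lambda>x. T - x) ` {t..T})"
      using C1_onD[OF f] sub that by (meson has_field_derivative_subset image_eqI subsetD)
    have 2: "((\<lambda>x. T - x) has_real_derivative -1) (at x within {t..T})"
      by (auto intro!: derivative_eq_intros)
    show ?thesis using DERIV_image_chain[OF 1 2] by (simp add: comp_def)
  qed
  moreover have "continuous_on {t..T} (\<lambda>x. - f' (T - x))"
    by (intro continuous_on_minus continuous_on_compose2[OF C1_on_continuous_deriv[OF f] _ sub] continuous_intros)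
  ultimately show ?thesis by (simp add: C1_on_def)
qed

lemma integral_square_nonneg:
  assumes "C1_on g g' {s..t}"
  shows "0 \<le> integral {s..t} (\<lambda>x. (g x)\<^sup>2)"
  using C1_on_continuous[OF assms]
  by (intro integral_nonneg integrable_continuous_real continuous_intros) auto

text \<open>The squared distance of \<open>g\<close> to a constant, written without the integral of \<open>g\<close> itself. The
  covariance of a Brownian increment with \<open>\<integral> g dW\<close> will appear in the same polarized form, through the
  variances of the integrals of \<open>1 + g\<close>, \<open>1\<close> and \<open>g\<close>.\<close>
lemma integral_square_diff:
  assumes g: "C1_on g g' {s..t}" and "s \<le> t"
  shows "integral {s..t} (\<lambda>x. (c - g x)\<^sup>2)
    = c\<^sup>2 * (t - s) - c * (integral {s..t} (\<lambda>x. (1 + g x)\<^sup>2) - (t - s) - integral {s..t} (\<lambda>x. (g x)\<^sup>2))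
      + integral {s..t} (\<lambda>x. (g x)\<^sup>2)"
proof -
  have [simp]: "g integrable_on {s..t}" "(\<lambda>x. (g x)\<^sup>2) integrable_on {s..t}"
    using C1_on_continuous[OF g] by (auto intro!: integrable_continuous_real continuous_intros)
  have lin: "integral {s..t} (\<lambda>x. d + e * g x + (g x)\<^sup>2)
      = d * (t - s) + e * integral {s..t} g + integral {s..t} (\<lambda>x. (g x)\<^sup>2)" for d e
  proof -
    have "((\<lambda>x. d + e * g x + (g x)\<^sup>2) has_integral
        (t - s) *\<^sub>R d + e * integral {s..t} g + integral {s..t} (\<lambda>x. (g x)\<^sup>2)) {s..t}"
      using \<open>s \<le> t\<close> has_integral_const_real[of d s t]
      by (intro has_integral_add has_integral_mult_right integrable_integral) auto
    then show ?thesis by (simp add: integral_unique mult.commute)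
  qed
  have "(c - g x)\<^sup>2 = c\<^sup>2 + (- (2 * c)) * g x + (g x)\<^sup>2" for x
    by (simp add: power2_eq_square algebra_simps)
  moreover have "(1 + g x)\<^sup>2 = 1 + 2 * g x + (g x)\<^sup>2" for x
    by (simp add: power2_eq_square algebra_simps)
  ultimately show ?thesis by (simp only: lin) (simp add: algebra_simps)
qed

lemma integrable_C1_deriv:
  assumes "C1_on g g' {s..t}" "continuous_on {s..t} w"
  shows "(\<lambda>x. g' x * w x) integrable_on {s..t}"
  using assms by (intro integrable_continuous_real continuous_intros) (auto simp: C1_on_def)

lemma parts_integral_refl [simp]: "parts_integral g g' w s s = 0"
  by (simp add: parts_integral_def)

lemma parts_integral_combine:
  assumes "C1_on g g' {s..t}" "continuous_on {s..t} w" "s \<le> m" "m \<le> t"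
  shows "parts_integral g g' w s t = parts_integral g g' w s m + parts_integral g g' w m t"
  using Henstock_Kurzweil_Integration.integral_combine[OF assms(3,4) integrable_C1_deriv[OF assms(1,2)]]
  by (simp add: parts_integral_def)

lemma parts_integral_add:
  assumes "C1_on f f' {s..t}" "C1_on g g' {s..t}" "continuous_on {s..t} w"
  shows "parts_integral (\<lambda>x. f x + g x) (\<lambda>x. f' x + g' x) w s t
    = parts_integral f f' w s t + parts_integral g g' w s t"
  using integral_add[OF integrable_C1_deriv[OF assms(1,3)] integrable_C1_deriv[OF assms(2,3)]]
  by (simp add: parts_integral_def algebra_simps)

lemma parts_integral_cmult:
  "parts_integral (\<lambda>x. c * g x) (\<lambda>x. c * g' x) w s t = c * parts_integral g g' w s t"
  by (simp add: parts_integral_def algebra_simps)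

lemma parts_integral_one: "parts_integral (\<lambda>x. 1) (\<lambda>x. 0) w s t = w t - w s"
  by (simp add: parts_integral_def)

lemma parts_integral_cong:
  assumes "\<And>x. x \<in> {s..t} \<Longrightarrow> w x = v x" "s \<le> t"
  shows "parts_integral g g' w s t = parts_integral g g' v s t"
proof -
  have "integral {s..t} (\<lambda>x. g' x * w x) = integral {s..t} (\<lambda>x. g' x * v x)"
    using assms by (intro integral_cong) auto
  then show ?thesis using assms by (simp add: parts_integral_def)
qed

lemma C1_on_FTC:
  assumes g: "C1_on g g' {s..t}" and "s \<le> t"
  shows "(g' has_integral (g t - g s)) {s..t}"
  using assms by (intro fundamental_theorem_of_calculus)
    (auto simp: C1_on_def has_real_derivative_iff_has_vector_derivative)

lemma continuous_on_parts_integral: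
  assumes h: "C1_on h h' {0..T}" and w: "continuous_on {0..T} w"
  shows "continuous_on {0..T} (\<lambda>x. parts_integral h h' w 0 x)"
proof -
  have "continuous_on {0..T} (\<lambda>x. integral {0..x} (\<lambda>y. h' y * w y))"
    using w C1_on_continuous_deriv[OF h]
    by (intro C1_on_continuous[OF C1_on_integral] continuous_intros)
  then show ?thesis unfolding parts_integral_def
    using w C1_on_continuous[OF h] by (intro continuous_intros)
qed

text \<open>Both sides are integrals of \<open>g'\<close> over the cell, against the constant \<open>w y\<close> and against \<open>w\<close>
  respectively, so the oscillation of \<open>w\<close> controls their difference.\<close>
lemma parts_integral_cell:
  assumes g: "C1_on g g' {x..y}" and w: "continuous_on {x..y} w" and "x \<le> y"
    and B: "\<And>z. z \<in> {x..y} \<Longrightarrow> \<bar>g' z\<bar> \<le> B"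
    and e: "\<And>z. z \<in> {x..y} \<Longrightarrow> \<bar>w y - w z\<bar> \<le> e"
  shows "\<bar>g x * (w y - w x) - parts_integral g g' w x y\<bar> \<le> B * e * (y - x)"
proof -
  have c: "continuous_on {x..y} g'" using g by (simp add: C1_on_def)
  have "integral {x..y} (\<lambda>z. g' z * (w z - w y))
      = integral {x..y} (\<lambda>z. g' z * w z) - integral {x..y} g' * w y"
    using c w by (simp add: right_diff_distrib integral_diff integrable_continuous_real continuous_intros)
  also have "integral {x..y} g' = g y - g x"
    using C1_on_FTC[OF g \<open>x \<le> y\<close>] by (rule integral_unique)
  finally have "g x * (w y - w x) - parts_integral g g' w x y
      = integral {x..y} (\<lambda>z. g' z * (w z - w y))"
    by (simp add: parts_integral_def algebra_simps)
  moreover have "norm (integral {x..y} (\<lambda>z. g' z * (w z - w y))) \<le> (B * e) * (y - x)"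
  proof (rule integral_bound[OF \<open>x \<le> y\<close>])
    show "continuous_on {x..y} (\<lambda>z. g' z * (w z - w y))"
      using c w by (intro continuous_intros)
    fix z assume z: "z \<in> {x..y}"
    have "\<bar>w z - w y\<bar> \<le> e" using e[OF z] by simp
    then show "norm (g' z * (w z - w y)) \<le> B * e"
      using B[OF z] by (simp add: abs_mult) (intro mult_mono; simp; linarith)
  qed
  ultimately show ?thesis by simp
qed

text \<open>The equidistant partition has \<open>Suc n\<close> cells, which avoids a case distinction at zero.\<close>
definition grid :: "real \<Rightarrow> real \<Rightarrow> nat \<Rightarrow> nat \<Rightarrow> real" where
  "grid s t n k = s + (t - s) * real k / real (Suc n)"

lemma grid_0 [simp]: "grid s t n 0 = s" and grid_last [simp]: "grid s t n (Suc n) = t"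
  by (auto simp: grid_def field_simps simp del: of_nat_Suc)

lemma grid_step: "grid s t n (Suc k) - grid s t n k = (t - s) / real (Suc n)"
  by (simp add: grid_def divide_simps) (simp add: algebra_simps)

lemma grid_mono: "s \<le> t \<Longrightarrow> j \<le> k \<Longrightarrow> grid s t n j \<le> grid s t n k"
  by (auto simp: grid_def intro!: divide_right_mono mult_left_mono)

lemma grid_in:
  assumes "s \<le> t" "k \<le> Suc n" shows "grid s t n k \<in> {s..t}"
  using grid_mono[OF assms(1), of 0 k n] grid_mono[OF assms, of n] by simp

lemma parts_integral_sum:
  assumes g: "C1_on g g' {s..t}" and w: "continuous_on {s..t} w"
    and x: "\<And>k. k < N \<Longrightarrow> x k \<le> x (Suc k)" "x 0 = s" "x N \<le> t"
  shows "(\<Sum>k<N. parts_integral g g' w (x k) (x (Suc k))) = parts_integral g g' w s (x N)"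
  using x
proof (induction N)
  case (Suc N)
  have le: "s \<le> x M" if "M \<le> Suc N" for M using that
    by (induction M) (use Suc.prems in \<open>auto intro: order_trans\<close>)
  have "{s..x (Suc N)} \<subseteq> {s..t}" using Suc.prems by auto
  then have "parts_integral g g' w s (x (Suc N))
     = parts_integral g g' w s (x N) + parts_integral g g' w (x N) (x (Suc N))"
    using Suc.prems le g w
    by (intro parts_integral_combine) (auto intro: C1_on_subset continuous_on_subset)
  moreover have "x N \<le> t" using Suc.prems(1)[of N] Suc.prems(3) by simp
  ultimately show ?case using Suc by simp
qed (use x in simp)

definition riemann_sum :: "(real \<Rightarrow> real) \<Rightarrow> (real \<Rightarrow> real) \<Rightarrow> real \<Rightarrow> real \<Rightarrow> nat \<Rightarrow> real" where
  "riemann_sum g w s t n =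
     (\<Sum>k<Suc n. g (grid s t n k) * (w (grid s t n (Suc k)) - w (grid s t n k)))"

text \<open>The errors of the single cells are at most their length times \<open>sup |g'|\<close> times the modulus of
  continuity of \<open>w\<close>, so they sum to something arbitrarily small.\<close>
lemma riemann_sum_tendsto:
  assumes g: "C1_on g g' {s..t}" and w: "continuous_on {s..t} w" and "s \<le> t"
  shows "riemann_sum g w s t \<longlonglongrightarrow> parts_integral g g' w s t"
proof (rule metric_LIMSEQ_I)
  fix r :: real assume "0 < r"
  have "compact (g' ` {s..t})" using g by (auto simp: C1_on_def intro!: compact_continuous_image)
  then have "bounded (g' ` {s..t})" by (rule compact_imp_bounded)
  then obtain B where "0 < B" "\<forall>y\<in>g' ` {s..t}. norm y \<le> B"
    unfolding bounded_pos by blast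
  then have B: "0 < B" "\<And>z. z \<in> {s..t} \<Longrightarrow> \<bar>g' z\<bar> \<le> B"
    by simp_all
  \<comment> \<open>The summand \<open>1\<close> keeps the denominator positive when \<open>s = t\<close>.\<close>
  define e where "e = r / (2 * B * (t - s + 1))"
  have "0 < e" using \<open>0 < r\<close> B \<open>s \<le> t\<close> by (simp add: e_def)
  have "uniformly_continuous_on {s..t} w" using w by (simp add: compact_uniformly_continuous)
  then obtain d where d: "0 < d"
    "\<And>x y. x \<in> {s..t} \<Longrightarrow> y \<in> {s..t} \<Longrightarrow> \<bar>x - y\<bar> < d \<Longrightarrow> \<bar>w x - w y\<bar> < e"
    using \<open>0 < e\<close> unfolding uniformly_continuous_on_def dist_real_def
    by (metis abs_minus_commute)
  obtain N :: nat where N: "(t - s) / d < real N" using reals_Archimedean2 by blast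
  show "\<exists>N. \<forall>n\<ge>N. dist (riemann_sum g w s t n) (parts_integral g g' w s t) < r"
  proof (intro exI allI impI)
    fix n assume "N \<le> n"
    then have "(t - s) / d < real (Suc n)" using N by simp
    then have h: "(t - s) / real (Suc n) < d" using \<open>0 < d\<close> by (simp add: field_simps)
    let ?x = "grid s t n"
    have cell: "\<bar>g (?x k) * (w (?x (Suc k)) - w (?x k)) - parts_integral g g' w (?x k) (?x (Suc k))\<bar>
        \<le> B * e * (?x (Suc k) - ?x k)" if "k < Suc n" for k
    proof (rule parts_integral_cell)
      have sub: "{?x k..?x (Suc k)} \<subseteq> {s..t}"
        using grid_in[OF \<open>s \<le> t\<close>, of k n] grid_in[OF \<open>s \<le> t\<close>, of "Suc k" n] that by auto
      show "C1_on g g' {?x k..?x (Suc k)}" using g sub by (rule C1_on_subset)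
      show "continuous_on {?x k..?x (Suc k)} w" using w sub by (rule continuous_on_subset)
      show le: "?x k \<le> ?x (Suc k)" using \<open>s \<le> t\<close> by (simp add: grid_mono)
      fix z assume z: "z \<in> {?x k..?x (Suc k)}"
      show "\<bar>g' z\<bar> \<le> B" using B z sub by auto
      have "\<bar>?x (Suc k) - z\<bar> < d" using z h grid_step[of s t n k] by auto
      then show "\<bar>w (?x (Suc k)) - w z\<bar> \<le> e" using d(2)[of "?x (Suc k)" z] z sub le by fastforce
    qed
    have "parts_integral g g' w s t = (\<Sum>k<Suc n. parts_integral g g' w (?x k) (?x (Suc k)))"
      using parts_integral_sum[OF g w, of "Suc n" ?x] \<open>s \<le> t\<close> by (simp add: grid_mono)
    then have "\<bar>riemann_sum g w s t n - parts_integral g g' w s t\<bar>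
       = \<bar>\<Sum>k<Suc n. g (?x k) * (w (?x (Suc k)) - w (?x k)) - parts_integral g g' w (?x k) (?x (Suc k))\<bar>"
      by (simp only: riemann_sum_def sum_subtractf)
    also have "\<dots> \<le> (\<Sum>k<Suc n. B * e * (?x (Suc k) - ?x k))"
      using cell by (intro order_trans[OF sum_abs] sum_mono) auto
    also have "\<dots> = B * e * (t - s)"
      by (simp only: sum_distrib_left[symmetric] sum_lessThan_telescope grid_0 grid_last)
    also have "\<dots> < r"
    proof -
      have "B * e * (t - s) = r * ((t - s) / (2 * (t - s + 1)))" using B(1) by (simp add: e_def)
      also have "\<dots> < r * 1" using \<open>0 < r\<close> \<open>s \<le> t\<close> by (intro mult_strict_left_mono) auto
      finally show ?thesis by simp
    qed
    finally show "dist (riemann_sum g w s t n) (parts_integral g g' w s t) < r"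
      by (simp add: dist_real_def)
  qed
qed

text \<open>Riemann sums of ordinary integrals are thus a special case of those above, with the identity as
  path.\<close>
lemma parts_integral_ident:
  assumes f: "C1_on f f' {s..t}" and "s \<le> t"
  shows "parts_integral f f' (\<lambda>x. x) s t = integral {s..t} f"
proof -
  have "C1_on (\<lambda>x. f x * x) (\<lambda>x. f' x * x + f x * 1) {s..t}"
  proof (rule C1_on_mult[OF f])
    show "C1_on (\<lambda>x. x) (\<lambda>x. 1) {s..t}"
      unfolding C1_on_def by (auto intro: DERIV_ident)
  qed
  from C1_on_FTC[OF this \<open>s \<le> t\<close>]
  have "integral {s..t} (\<lambda>x. f' x * x + f x) = f t * t - f s * s"
    by (simp add: integral_unique)
  moreover have "integral {s..t} (\<lambda>x. f' x * x + f x) = integral {s..t} (\<lambda>x. f' x * x) + integral {s..t} f"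
  proof (rule integral_add)
    show "(\<lambda>x. f' x * x) integrable_on {s..t}"
      using integrable_C1_deriv[OF f, of "\<lambda>x. x"] by simp
    show "f integrable_on {s..t}"
      by (rule integrable_continuous_real[OF C1_on_continuous[OF f]])
  qed
  ultimately show ?thesis by (simp add: parts_integral_def)
qed

section \<open>Centred Gaussian laws\<close>

text \<open>The law is parametrized as the image of a standard normal variable, so that \<open>v = 0\<close> is the point
  mass at zero rather than a degenerate density. This value does occur, for instance for integrals
  over an interval of length zero.\<close>
definition gaussian :: "real \<Rightarrow> real measure" where
  "gaussian v = distr std_normal_distribution borel (\<lambda>x. sqrt v * x)"

lemma real_distribution_gaussian: "real_distribution (gaussian v)"
proof -
  interpret std: real_distribution std_normal_distribution
    by (rule real_dist_normal_dist)
  show ?thesis unfolding gaussian_def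
    by (intro std.real_distribution_distr) simp
qed

lemma char_gaussian:
  assumes "0 \<le> v"
  shows "char (gaussian v) \<theta> = complex_of_real (exp (- (\<theta>\<^sup>2 * v) / 2))"
proof -
  have "char (gaussian v) \<theta> = char std_normal_distribution (\<theta> * sqrt v)"
    by (simp add: gaussian_def char_def integral_distr mult.assoc)
  then show ?thesis using assms by (simp add: char_std_normal_distribution power_mult_distrib)
qed

lemma
  shows integrable_gaussian_exp: "integrable (gaussian v) (\<lambda>x. exp (c * x))" (is ?A)
    and integral_gaussian_exp: "0 \<le> v \<Longrightarrow> (\<integral>x. exp (c * x) \<partial>gaussian v) = exp (c\<^sup>2 * v / 2)" (is "_ \<Longrightarrow> ?B")
proof -
  \<comment> \<open>Completing the square: tilting the standard normal density shifts its mean.\<close>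
  have shift: "std_normal_density x * exp (d * x) = exp (d\<^sup>2 / 2) * normal_density d 1 x" for x d :: real
  proof -
    have "- x\<^sup>2 / 2 + d * x = d\<^sup>2 / 2 + (- (x - d)\<^sup>2 / 2)"
      by (simp add: power2_eq_square field_simps)
    then have "exp (- x\<^sup>2 / 2) * exp (d * x) = exp (d\<^sup>2 / 2) * exp (- (x - d)\<^sup>2 / 2)"
      by (simp only: exp_add[symmetric])
    then show ?thesis by (simp add: normal_density_def)
  qed
  have "integrable std_normal_distribution (\<lambda>x. exp (c * (sqrt v * x)))"
    using shift[of _ "c * sqrt v"] by (subst integrable_density) (simp_all add: mult.assoc)
  then show ?A unfolding gaussian_def by (subst integrable_distr_eq) auto
  assume "0 \<le> v"
  have "(\<integral>x. exp (c * x) \<partial>gaussian v) = (\<integral>x. exp (c * (sqrt v * x)) \<partial>std_normal_distribution)"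
    unfolding gaussian_def by (subst integral_distr) auto
  also have "\<dots> = (\<integral>x. std_normal_density x * exp (c * sqrt v * x) \<partial>lborel)"
    by (subst integral_density) (simp_all add: mult.assoc)
  also have "\<dots> = exp ((c * sqrt v)\<^sup>2 / 2)" by (simp add: shift)
  finally show ?B using \<open>0 \<le> v\<close> by (simp add: power_mult_distrib)
qed

lemma
  shows integrable_gaussian_id: "integrable (gaussian v) (\<lambda>x. x)" (is ?A)
    and integrable_gaussian_square: "integrable (gaussian v) (\<lambda>x. x\<^sup>2)" (is ?B)
    and integral_gaussian_id: "(\<integral>x. x \<partial>gaussian v) = 0" (is ?C)
    and integral_gaussian_square: "0 \<le> v \<Longrightarrow> (\<integral>x. x\<^sup>2 \<partial>gaussian v) = v" (is "_ \<Longrightarrow> ?D")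
proof -
  have 1: "has_bochner_integral lborel (\<lambda>x. std_normal_density x * x) 0"
    using std_normal_moment_odd[of 0] by simp
  have 2: "has_bochner_integral lborel (\<lambda>x. std_normal_density x * x\<^sup>2) 1"
    using std_normal_moment_even[of 1] by (simp add: fact_numeral)
  have 3: "has_bochner_integral std_normal_distribution (\<lambda>x. x) 0"
    by (rule has_bochner_integral_density) (use 1 in auto)
  have 4: "has_bochner_integral std_normal_distribution (\<lambda>x. x\<^sup>2) 1"
    by (rule has_bochner_integral_density) (use 2 in auto)
  note i1 = integrable.intros[OF 3] and i2 = integrable.intros[OF 4]
  note e1 = has_bochner_integral_integral_eq[OF 3] and e2 = has_bochner_integral_integral_eq[OF 4]
  show ?A unfolding gaussian_def
    by (subst integrable_distr_eq) (auto intro!: integrable_mult_right i1)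
  show ?B unfolding gaussian_def
    by (subst integrable_distr_eq) (auto simp: power_mult_distrib intro!: integrable_mult_right i2)
  show ?C unfolding gaussian_def
    by (subst integral_distr) (auto simp: e1)
  show ?D if "0 \<le> v" unfolding gaussian_def
    using that by (subst integral_distr) (auto simp: e2 power_mult_distrib)
qed

section \<open>Increments of Brownian motion over the augmented filtration\<close>

lemma (in prob_space) indep_var_from_indep_set:
  assumes "indep_set A B" "X \<in> measurable M N" "Y \<in> measurable M L"
    and "\<And>S. S \<in> sets N \<Longrightarrow> X -` S \<inter> space M \<in> A"
    and "\<And>S. S \<in> sets L \<Longrightarrow> Y -` S \<inter> space M \<in> B"
  shows "indep_var N X L Y"
  unfolding indep_var_eq
proof (intro conjI assms(2,3) indep_set_sigma_sets)
  show "indep_set {X -` S \<inter> space M |S. S \<in> sets N} {Y -` S \<inter> space M |S. S \<in> sets L}"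
    using assms by (intro indep_setI) (auto intro!: indep_setD[OF assms(1)] measurable_sets)
  show "Int_stable {X -` S \<inter> space M |S. S \<in> sets N}"
  proof (intro Int_stableI, safe)
    fix S S' assume "S \<in> sets N" "S' \<in> sets N"
    then show "\<exists>R. X -` S \<inter> space M \<inter> (X -` S' \<inter> space M) = X -` R \<inter> space M \<and> R \<in> sets N"
      by (intro exI[of _ "S \<inter> S'"]) auto
  qed
  show "Int_stable {Y -` S \<inter> space M |S. S \<in> sets L}"
  proof (intro Int_stableI, safe)
    fix S S' assume "S \<in> sets L" "S' \<in> sets L"
    then show "\<exists>R. Y -` S \<inter> space M \<inter> (Y -` S' \<inter> space M) = Y -` R \<inter> space M \<and> R \<in> sets L"
      by (intro exI[of _ "S \<inter> S'"]) auto
  qed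
qed

text \<open>A sub-\<open>\<sigma>\<close>-algebra that contains all null sets does not see a change on a null set. This is why
  pathwise limits, defined only where the path is continuous, are adapted to the augmented
  filtration.\<close>
lemma (in complete_measure) measurable_AE_eq:
  fixes X Y :: "'a \<Rightarrow> 'b::topological_space"
  assumes N: "space N = space M" "null_sets M \<subseteq> sets N"
    and X: "X \<in> borel_measurable N" and eq: "AE \<omega> in M. X \<omega> = Y \<omega>"
  shows "Y \<in> borel_measurable N"
proof (rule measurableI)
  fix B :: "'b set" assume B: "B \<in> sets borel"
  define E where "E = {\<omega> \<in> space M. X \<omega> \<noteq> Y \<omega>}"
  have E: "E \<in> null_sets M" using eq by (simp add: AE_iff_null_sets E_def)
  have "Y -` B \<inter> space N = (X -` B \<inter> space N - E) \<union> (Y -` B \<inter> E)"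
    using N(1) by (auto simp: E_def)
  moreover have "Y -` B \<inter> E \<in> null_sets M" by (rule complete2[OF _ E]) auto
  ultimately show "Y -` B \<inter> space N \<in> sets N"
    using E N(2) measurable_sets[OF X B] by (metis sets.Diff sets.Un subsetD)
qed simp

locale complete_brownian = prob_space Q + complete_measure Q for Q :: "'a measure" +
  fixes W :: "real \<Rightarrow> 'a \<Rightarrow> real"
  assumes bm: "brownian_motion Q W"
begin

abbreviation F :: "real \<Rightarrow> 'a measure" where "F \<equiv> augmented_filtration Q W"

lemma measurable_W: "0 \<le> t \<Longrightarrow> W t \<in> borel_measurable Q"
  using bm by (simp add: brownian_motion_def)

lemma AE_continuous_W: "AE \<omega> in Q. continuous_on {0..} (\<lambda>t. W t \<omega>)"
  using bm by (simp add: brownian_motion_def)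

lemma subalgebra_F: "subalgebra Q (F t)"
  by (intro subalgebra_augmented_filtration measurable_W)

lemma sets_F: "A \<in> sets (F t) \<Longrightarrow> A \<in> sets Q"
  using subalgebra_F by (auto simp: subalgebra_def)

lemma measurable_F: "X \<in> measurable (F t) N \<Longrightarrow> X \<in> measurable Q N"
  using subalgebra_F by (rule measurable_from_subalg)

lemma F_mono:
  assumes "s \<le> t" "X \<in> measurable (F s) N"
  shows "X \<in> measurable (F t) N"
proof -
  interpret filtration "space Q" F by (rule filtration_augmented_filtration)
  have "sets (F s) \<subseteq> sets (F t)" by (rule sets_F_mono[OF assms(1)])
  then have "subalgebra (F t) (F s)" by (simp add: subalgebra_def)
  from measurable_from_subalg[OF this assms(2)] show ?thesis .
qed

lemma null_sets_F: "N \<in> null_sets Q \<Longrightarrow> N \<in> sets (F t)"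
  by (simp add: sets_augmented_filtration sigma_sets.Basic)

lemma measurable_F_W: "0 \<le> s \<Longrightarrow> s \<le> t \<Longrightarrow> W s \<in> borel_measurable (F t)"
proof (rule measurableI)
  fix B :: "real set" assume "0 \<le> s" "s \<le> t" "B \<in> sets borel"
  then have "W s -` B \<inter> space Q \<in> sets (natural_filtration Q W t)"
    unfolding sets_natural_filtration by (intro sigma_sets.Basic) auto
  then show "W s -` B \<inter> space (F t) \<in> sets (F t)"
    by (simp add: sets_augmented_filtration sigma_sets.Basic)
qed simp

lemma measurable_F_AE_eq:
  fixes X Y :: "'a \<Rightarrow> 'b::topological_space"
  assumes "X \<in> borel_measurable (F t)" "AE \<omega> in Q. X \<omega> = Y \<omega>"
  shows "Y \<in> borel_measurable (F t)"
  by (rule measurable_AE_eq[OF _ _ assms]) (auto intro: null_sets_F)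

lemma measurable_Q_AE_eq:
  fixes X Y :: "'a \<Rightarrow> 'b::topological_space"
  assumes "X \<in> borel_measurable Q" "AE \<omega> in Q. X \<omega> = Y \<omega>"
  shows "Y \<in> borel_measurable Q"
  by (rule measurable_AE_eq[OF _ _ assms]) auto

lemma measurable_F_AE_limit:
  fixes S :: "nat \<Rightarrow> 'a \<Rightarrow> real"
  assumes "\<And>n. S n \<in> borel_measurable (F t)" "AE \<omega> in Q. (\<lambda>n. S n \<omega>) \<longlonglongrightarrow> X \<omega>"
  shows "X \<in> borel_measurable (F t)"
proof (rule measurable_F_AE_eq)
  show "(\<lambda>\<omega>. lim (\<lambda>n. S n \<omega>)) \<in> borel_measurable (F t)"
    using assms(1) by (rule borel_measurable_lim_metric)
  show "AE \<omega> in Q. lim (\<lambda>n. S n \<omega>) = X \<omega>"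
    using assms(2) by eventually_elim (rule limI)
qed

text \<open>Events of the augmentation differ from natural ones by null sets only, so the independence of
  increments carries over to it.\<close>
lemma F_natural_AE:
  assumes "A \<in> sets (F s)"
  shows "\<exists>B\<in>sets (natural_filtration Q W s). AE \<omega> in Q. \<omega> \<in> A \<longleftrightarrow> \<omega> \<in> B"
  using assms unfolding sets_augmented_filtration
proof (induction rule: sigma_sets.induct)
  case (Basic A)
  then show ?case
  proof
    assume "A \<in> null_sets Q"
    then show ?thesis by (intro bexI[of _ "{}"]) (auto intro: AE_not_in)
  qed auto
next
  case (Compl A)
  then obtain B where "B \<in> sets (natural_filtration Q W s)" "AE \<omega> in Q. \<omega> \<in> A \<longleftrightarrow> \<omega> \<in> B" by auto
  then show ?case
    by (intro bexI[of _ "space (natural_filtration Q W s) - B"] sets.compl_sets) auto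
next
  case (Union A)
  then have "\<forall>i. \<exists>B. B\<in>sets (natural_filtration Q W s) \<and> (AE \<omega> in Q. \<omega> \<in> A i \<longleftrightarrow> \<omega> \<in> B)" by blast
  then obtain B where B: "\<And>i. B i \<in> sets (natural_filtration Q W s)"
    and eq: "\<And>i. AE \<omega> in Q. \<omega> \<in> A i \<longleftrightarrow> \<omega> \<in> B i"
    using choice[of "\<lambda>i B. B \<in> sets (natural_filtration Q W s) \<and> (AE \<omega> in Q. \<omega> \<in> A i \<longleftrightarrow> \<omega> \<in> B)"]
    by blast
  have "AE \<omega> in Q. \<forall>i. \<omega> \<in> A i \<longleftrightarrow> \<omega> \<in> B i" using eq by (simp add: AE_all_countable)
  then have "AE \<omega> in Q. \<omega> \<in> (\<Union>i. A i) \<longleftrightarrow> \<omega> \<in> (\<Union>i. B i)"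
    by eventually_elim auto
  then show ?case
    using B by (intro bexI[of _ "\<Union>i. B i"]) auto
qed (intro bexI[of _ "{}"]; simp)

lemma indep_set_F_increment:
  assumes "0 \<le> s" "s < t"
  shows "indep_set (sets (F s)) (sets (vimage_algebra (space Q) (\<lambda>\<omega>. W t \<omega> - W s \<omega>) borel))"
proof (rule indep_setI)
  let ?V = "vimage_algebra (space Q) (\<lambda>\<omega>. W t \<omega> - W s \<omega>) borel"
  have ind: "indep_set (sets ?V) (sets (natural_filtration Q W s))"
    using bm assms by (simp add: brownian_motion_def)
  show "sets (F s) \<subseteq> events" using sets_F by auto
  show V: "sets ?V \<subseteq> events"
    using ind unfolding indep_sets2_eq by simp
  fix A C assume A: "A \<in> sets (F s)" and C: "C \<in> sets ?V"
  obtain B where B: "B \<in> sets (natural_filtration Q W s)" and AB: "AE \<omega> in Q. \<omega> \<in> A \<longleftrightarrow> \<omega> \<in> B"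
    using F_natural_AE[OF A] by auto
  have [measurable]: "A \<in> events" "C \<in> events" "B \<in> events"
    using sets_F[OF A] V C B ind unfolding indep_sets2_eq by auto
  have "prob (A \<inter> C) = prob (C \<inter> B)" using AB by (intro finite_measure_eq_AE) auto
  also have "\<dots> = prob C * prob B" by (rule indep_setD[OF ind C B])
  also have "prob B = prob A" using AB by (intro finite_measure_eq_AE) auto
  finally show "prob (A \<inter> C) = prob A * prob C" by simp
qed

lemma indep_var_F_increment:
  assumes "0 \<le> s" "s < t" and Y: "Y \<in> measurable (F s) N" and f: "f \<in> measurable borel L"
  shows "indep_var N Y L (\<lambda>\<omega>. f (W t \<omega> - W s \<omega>))"
proof (rule indep_var_from_indep_set[OF indep_set_F_increment[OF assms(1,2)]])
  have W[measurable]: "W t \<in> borel_measurable Q" "W s \<in> borel_measurable Q"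
    using assms by (auto intro: measurable_W)
  show "Y \<in> measurable Q N" using Y by (rule measurable_F)
  show "(\<lambda>\<omega>. f (W t \<omega> - W s \<omega>)) \<in> measurable Q L" using f by measurable
  show "Y -` S \<inter> space Q \<in> sets (F s)" if "S \<in> sets N" for S
    using measurable_sets[OF Y that] by simp
  show "(\<lambda>\<omega>. f (W t \<omega> - W s \<omega>)) -` S \<inter> space Q
      \<in> sets (vimage_algebra (space Q) (\<lambda>\<omega>. W t \<omega> - W s \<omega>) borel)" if "S \<in> sets L" for S
  proof -
    have "f -` S \<in> sets borel" using measurable_sets[OF f that] by simp
    from in_vimage_algebra[OF this, of "\<lambda>\<omega>. W t \<omega> - W s \<omega>" "space Q"]
    show ?thesis by (simp add: vimage_def)
  qed
qed

lemma char_increment: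
  assumes "0 \<le> s" "s < t"
  shows "(\<integral>\<omega>. iexp (\<theta> * (W t \<omega> - W s \<omega>)) \<partial>Q) = complex_of_real (exp (- (\<theta>\<^sup>2 * (t - s)) / 2))"
proof -
  have [measurable]: "W t \<in> borel_measurable Q" "W s \<in> borel_measurable Q"
    using assms by (auto intro: measurable_W)
  define X where "X \<omega> = (W t \<omega> - W s \<omega>) / sqrt (t - s)" for \<omega>
  have "distributed Q lborel (\<lambda>\<omega>. W t \<omega> - W s \<omega>) (normal_density 0 (sqrt (t - s)))"
    using bm assms by (simp add: brownian_motion_def)
  then have "distributed Q lborel X std_normal_density"
    using assms by (subst (asm) normal_standard_normal_convert) (auto simp: X_def[abs_def])
  then have d: "distr Q lborel X = std_normal_distribution" by (simp add: distributed_def)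
  have [measurable]: "X \<in> borel_measurable Q" by (simp add: X_def[abs_def])
  have "(\<integral>\<omega>. iexp (\<theta> * (W t \<omega> - W s \<omega>)) \<partial>Q) = (\<integral>\<omega>. iexp (\<theta> * sqrt (t - s) * X \<omega>) \<partial>Q)"
    using assms by (simp add: X_def)
  also have "\<dots> = (\<integral>x. iexp (\<theta> * sqrt (t - s) * x) \<partial>distr Q lborel X)"
    by (subst integral_distr) auto
  also have "\<dots> = char std_normal_distribution (\<theta> * sqrt (t - s))"
    by (simp add: d char_def)
  finally show ?thesis using assms by (simp add: char_std_normal_distribution power_mult_distrib)
qed

lemma expectation_times_iexp_increment:
  fixes Y :: "'a \<Rightarrow> complex"
  assumes "0 \<le> s" "s \<le> t" "Y \<in> borel_measurable (F s)" "integrable Q Y"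
  shows "(\<integral>\<omega>. Y \<omega> * iexp (\<theta> * (W t \<omega> - W s \<omega>)) \<partial>Q)
    = (\<integral>\<omega>. Y \<omega> \<partial>Q) * complex_of_real (exp (- (\<theta>\<^sup>2 * (t - s)) / 2))"
proof (cases "s = t")
  case False
  then have "s < t" using assms by simp
  have [measurable]: "W t \<in> borel_measurable Q" "W s \<in> borel_measurable Q"
    using assms by (auto intro: measurable_W)
  have "indep_var borel Y borel (\<lambda>\<omega>. iexp (\<theta> * (W t \<omega> - W s \<omega>)))"
    using \<open>0 \<le> s\<close> \<open>s < t\<close> assms(3)
    by (rule indep_var_F_increment[where f="\<lambda>x. iexp (\<theta> * x)"]) simp
  moreover have "integrable Q (\<lambda>\<omega>. iexp (\<theta> * (W t \<omega> - W s \<omega>)))"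
    by (rule integrable_const_bound[where B=1]) auto
  ultimately show ?thesis
    using indep_var_lebesgue_integral[of Y "\<lambda>\<omega>. iexp (\<theta> * (W t \<omega> - W s \<omega>))"] assms(4)
      char_increment[OF \<open>0 \<le> s\<close> \<open>s < t\<close>, of \<theta>] by metis
qed simp

text \<open>Conditioning on the left end of the last cell splits off one independent Gaussian increment;
  the event \<open>A\<close> is kept along in order to obtain independence of the past together with the law.\<close>
lemma char_step_sum:
  assumes A: "A \<in> sets (F (x 0))" and x0: "0 \<le> x 0" and x: "\<And>k. k < N \<Longrightarrow> x k \<le> x (Suc k)"
  shows "(\<integral>\<omega>. indicator A \<omega> * iexp (\<theta> * (\<Sum>k<N. c k * (W (x (Suc k)) \<omega> - W (x k) \<omega>))) \<partial>Q)
    = complex_of_real (prob A * exp (- (\<theta>\<^sup>2 * (\<Sum>k<N. (c k)\<^sup>2 * (x (Suc k) - x k))) / 2))"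
  using x
proof (induction N)
  case 0
  have "(\<integral>\<omega>. (indicator A \<omega> :: complex) \<partial>Q) = (\<integral>\<omega>. complex_of_real (indicator A \<omega>) \<partial>Q)"
    by (intro Bochner_Integration.integral_cong) (auto simp: indicator_def)
  also have "\<dots> = complex_of_real (prob A)"
    using sets_F[OF A] by (subst integral_complex_of_real) simp
  finally show ?case by simp
next
  case (Suc N)
  define S where "S N \<omega> = (\<Sum>k<N. c k * (W (x (Suc k)) \<omega> - W (x k) \<omega>))" for N \<omega>
  define Y :: "'a \<Rightarrow> complex" where "Y \<omega> = indicator A \<omega> * iexp (\<theta> * S N \<omega>)" for \<omega>
  have mono: "x i \<le> x j" if "i \<le> j" "j \<le> Suc N" for i j
    using that by (induction j) (use Suc.prems in \<open>auto simp: le_Suc_eq intro: order_trans\<close>)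
  have pos: "0 \<le> x i" if "i \<le> Suc N" for i using mono[of 0 i] that x0 by auto
  have [measurable]: "W (x i) \<in> borel_measurable (F (x N))" if "i \<le> N" for i
    using that pos mono by (intro measurable_F_W) auto
  have "(indicator A :: 'a \<Rightarrow> complex) \<in> borel_measurable (F (x 0))"
    using A by (rule borel_measurable_indicator)
  then have IA: "(indicator A :: 'a \<Rightarrow> complex) \<in> borel_measurable (F (x N))"
    using mono[of 0 N] by (intro F_mono[of "x 0" "x N"]) auto
  have "S N \<in> borel_measurable (F (x N))"
    unfolding S_def by (intro borel_measurable_sum) auto
  from measurable_compose[OF this, of "\<lambda>x. iexp (\<theta> * x)" borel] IA
  have Ym: "Y \<in> borel_measurable (F (x N))"
    unfolding Y_def by (intro borel_measurable_times) auto
  have Yi: "integrable Q Y"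
    using measurable_F[OF Ym] by (intro integrable_const_bound[where B=1]) (auto simp: Y_def norm_mult indicator_def)
  have "(\<integral>\<omega>. indicator A \<omega> * iexp (\<theta> * S (Suc N) \<omega>) \<partial>Q)
    = (\<integral>\<omega>. Y \<omega> * iexp ((\<theta> * c N) * (W (x (Suc N)) \<omega> - W (x N) \<omega>)) \<partial>Q)"
    by (simp add: S_def Y_def algebra_simps exp_add[symmetric])
  also have "\<dots> = (\<integral>\<omega>. Y \<omega> \<partial>Q) * complex_of_real (exp (- ((\<theta> * c N)\<^sup>2 * (x (Suc N) - x N)) / 2))"
    using pos[of N] Suc.prems Ym Yi by (intro expectation_times_iexp_increment) auto
  also have "(\<integral>\<omega>. Y \<omega> \<partial>Q)
    = complex_of_real (prob A * exp (- (\<theta>\<^sup>2 * (\<Sum>k<N. (c k)\<^sup>2 * (x (Suc k) - x k))) / 2))"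
    using Suc by (simp add: Y_def S_def)
  also have "\<dots> * complex_of_real (exp (- ((\<theta> * c N)\<^sup>2 * (x (Suc N) - x N)) / 2))
    = complex_of_real (prob A * exp (- (\<theta>\<^sup>2 * (\<Sum>k<Suc N. (c k)\<^sup>2 * (x (Suc k) - x k))) / 2))"
    by (simp only: of_real_mult[symmetric] mult.assoc exp_add[symmetric])
       (simp add: power_mult_distrib field_simps)
  finally show ?case by (simp add: S_def)
qed

end

section \<open>The Wiener integral of a continuously differentiable function\<close>

context complete_brownian
begin

definition wiener :: "(real \<Rightarrow> real) \<Rightarrow> (real \<Rightarrow> real) \<Rightarrow> real \<Rightarrow> real \<Rightarrow> 'a \<Rightarrow> real" where
  "wiener g g' s t \<omega> = parts_integral g g' (\<lambda>x. W x \<omega>) s t"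

lemma AE_continuous_W_Icc: "0 \<le> s \<Longrightarrow> AE \<omega> in Q. continuous_on {s..t} (\<lambda>x. W x \<omega>)"
  using AE_continuous_W by eventually_elim (auto intro: continuous_on_subset)

lemma AE_riemann_sum_tendsto_wiener:
  assumes "C1_on g g' {s..t}" "0 \<le> s" "s \<le> t"
  shows "AE \<omega> in Q. (\<lambda>n. riemann_sum g (\<lambda>x. W x \<omega>) s t n) \<longlonglongrightarrow> wiener g g' s t \<omega>"
  using AE_continuous_W_Icc[OF \<open>0 \<le> s\<close>, of t]
  by eventually_elim (auto simp: wiener_def intro: riemann_sum_tendsto assms)

lemma measurable_F_riemann_sum:
  assumes "0 \<le> s" "s \<le> t"
  shows "(\<lambda>\<omega>. riemann_sum g (\<lambda>x. W x \<omega>) s t n) \<in> borel_measurable (F t)"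
proof -
  have "(\<lambda>\<omega>. W (grid s t n k) \<omega>) \<in> borel_measurable (F t)" if "k \<le> Suc n" for k
    using grid_in[OF \<open>s \<le> t\<close> that] assms by (intro measurable_F_W) auto
  then show ?thesis unfolding riemann_sum_def
    by (intro borel_measurable_sum borel_measurable_times borel_measurable_diff borel_measurable_const) auto
qed

lemma measurable_F_wiener:
  assumes "C1_on g g' {s..t}" "0 \<le> s" "s \<le> t"
  shows "wiener g g' s t \<in> borel_measurable (F t)"
  using measurable_F_riemann_sum[OF assms(2,3)] AE_riemann_sum_tendsto_wiener[OF assms]
  by (rule measurable_F_AE_limit)

text \<open>Riemann sums converge almost surely, and the exponentials are bounded by one, so dominated
  convergence applies on the left; on the right the sums of \<open>g\<^sup>2\<close> times the cell lengths are Riemann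
  sums of \<open>\<integral> g\<^sup>2\<close>.\<close>
lemma char_wiener_on_event:
  assumes g: "C1_on g g' {s..t}" and st: "0 \<le> s" "s \<le> t" and A: "A \<in> sets (F s)"
  shows "(\<integral>\<omega>. indicator A \<omega> * iexp (\<theta> * wiener g g' s t \<omega>) \<partial>Q)
    = complex_of_real (prob A * exp (- (\<theta>\<^sup>2 * integral {s..t} (\<lambda>x. (g x)\<^sup>2)) / 2))"
proof (rule LIMSEQ_unique)
  define R where "R n \<omega> = riemann_sum g (\<lambda>x. W x \<omega>) s t n" for n \<omega>
  have [measurable]: "A \<in> events" using A by (rule sets_F)
  have [measurable]: "R n \<in> borel_measurable Q" for n
    unfolding R_def by (rule measurable_F[OF measurable_F_riemann_sum[OF st]])
  have [measurable]: "wiener g g' s t \<in> borel_measurable Q"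
    by (rule measurable_F[OF measurable_F_wiener[OF g st]])
  show "(\<lambda>n. \<integral>\<omega>. indicator A \<omega> * iexp (\<theta> * R n \<omega>) \<partial>Q)
     \<longlonglongrightarrow> (\<integral>\<omega>. indicator A \<omega> * iexp (\<theta> * wiener g g' s t \<omega>) \<partial>Q)"
  proof (rule integral_dominated_convergence[where w="\<lambda>_. 1"])
    show "AE \<omega> in Q. (\<lambda>n. indicator A \<omega> * iexp (\<theta> * R n \<omega>))
        \<longlonglongrightarrow> indicator A \<omega> * iexp (\<theta> * wiener g g' s t \<omega>)"
      using AE_riemann_sum_tendsto_wiener[OF g st]
      by eventually_elim (auto simp: R_def intro!: tendsto_intros)
  qed (auto simp: norm_mult indicator_def)
  have g2: "C1_on (\<lambda>x. (g x)\<^sup>2) (\<lambda>x. g' x * g x + g x * g' x) {s..t}"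
    using C1_on_mult[OF g g] by (simp add: power2_eq_square)
  have "riemann_sum (\<lambda>x. (g x)\<^sup>2) (\<lambda>x. x) s t \<longlonglongrightarrow> integral {s..t} (\<lambda>x. (g x)\<^sup>2)"
    using riemann_sum_tendsto[OF g2 _ st(2), of "\<lambda>x. x"] parts_integral_ident[OF g2 st(2)] by simp
  moreover have "(\<integral>\<omega>. indicator A \<omega> * iexp (\<theta> * R n \<omega>) \<partial>Q)
      = complex_of_real (prob A * exp (- (\<theta>\<^sup>2 * riemann_sum (\<lambda>x. (g x)\<^sup>2) (\<lambda>x. x) s t n) / 2))" for n
    using char_step_sum[of A "grid s t n" "Suc n" \<theta> "\<lambda>k. g (grid s t n k)"] A st
    by (simp only: R_def riemann_sum_def grid_0) (simp add: grid_mono del: sum.lessThan_Suc)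
  ultimately show "(\<lambda>n. \<integral>\<omega>. indicator A \<omega> * iexp (\<theta> * R n \<omega>) \<partial>Q)
     \<longlonglongrightarrow> complex_of_real (prob A * exp (- (\<theta>\<^sup>2 * integral {s..t} (\<lambda>x. (g x)\<^sup>2)) / 2))"
    by (simp only:) (intro tendsto_intros, simp_all)
qed

text \<open>The preceding characteristic functions, divided by \<open>prob A\<close>, are those of the integral under
  the conditional probability given \<open>A\<close>. By Levy's uniqueness theorem the conditional law is the same
  Gaussian law for every \<open>A\<close>, which is independence of \<open>F s\<close>.\<close>
lemma prob_wiener_on_event:
  assumes g: "C1_on g g' {s..t}" and st: "0 \<le> s" "s \<le> t" and A: "A \<in> sets (F s)"
    and B: "B \<in> sets borel"
  shows "prob (A \<inter> (wiener g g' s t -` B \<inter> space Q))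
    = prob A * measure (gaussian (integral {s..t} (\<lambda>x. (g x)\<^sup>2))) B"
proof (cases "prob A = 0")
  case True
  have "prob (A \<inter> (wiener g g' s t -` B \<inter> space Q)) \<le> prob A"
    using sets_F[OF A] by (intro finite_measure_mono) auto
  with True show ?thesis by (simp add: measure_le_0_iff)
next
  case False
  define v where "v = integral {s..t} (\<lambda>x. (g x)\<^sup>2)"
  have [measurable]: "A \<in> events" using A by (rule sets_F)
  have X[measurable]: "wiener g g' s t \<in> borel_measurable Q"
    by (rule measurable_F[OF measurable_F_wiener[OF g st]])
  have "0 < prob A" using False by (simp add: zero_less_measure_iff)
  define U where "U = uniform_measure Q A"
  have U: "U = density Q (\<lambda>\<omega>. ennreal (indicator A \<omega> / prob A))"
    unfolding U_def uniform_measure_def using \<open>0 < prob A\<close>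
    by (intro arg_cong2[where f=density] refl ext)
       (auto simp: emeasure_eq_measure divide_ennreal indicator_def ennreal_1[symmetric] simp del: ennreal_1)
  have "prob_space U" unfolding U_def
    using \<open>0 < prob A\<close> by (intro prob_space_uniform_measure) (auto simp: emeasure_eq_measure)
  then interpret U: prob_space U .
  have [measurable]: "wiener g g' s t \<in> borel_measurable U" unfolding U_def by simp
  have "real_distribution (distr U borel (wiener g g' s t))"
    by (rule U.real_distribution_distr) simp
  moreover have "char (distr U borel (wiener g g' s t)) = char (gaussian v)"
  proof
    fix \<theta>
    have "char (distr U borel (wiener g g' s t)) \<theta> = (\<integral>\<omega>. iexp (\<theta> * wiener g g' s t \<omega>) \<partial>U)"
      by (simp add: char_def integral_distr)
    also have "\<dots> = (\<integral>\<omega>. (indicator A \<omega> / prob A) *\<^sub>R iexp (\<theta> * wiener g g' s t \<omega>) \<partial>Q)"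
      unfolding U using \<open>0 < prob A\<close> by (subst integral_density) auto
    also have "\<dots> = (\<integral>\<omega>. inverse (prob A) *\<^sub>R (indicator A \<omega> * iexp (\<theta> * wiener g g' s t \<omega>)) \<partial>Q)"
      by (intro Bochner_Integration.integral_cong) (auto simp: indicator_def divide_inverse)
    also have "\<dots> = inverse (prob A) *\<^sub>R (\<integral>\<omega>. indicator A \<omega> * iexp (\<theta> * wiener g g' s t \<omega>) \<partial>Q)"
      by (rule integral_scaleR_right)
    also have "\<dots> = char (gaussian v) \<theta>"
      using \<open>0 < prob A\<close> integral_square_nonneg[OF g]
      by (simp only: char_wiener_on_event[OF g st A] v_def char_gaussian) (simp add: scaleR_conv_of_real)
    finally show "char (distr U borel (wiener g g' s t)) \<theta> = char (gaussian v) \<theta>" .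
  qed
  ultimately have "distr U borel (wiener g g' s t) = gaussian v"
    using real_distribution_gaussian by (intro Levy_uniqueness)
  then have "measure (gaussian v) B = measure U (wiener g g' s t -` B \<inter> space U)"
    using B by (metis measure_distr \<open>wiener g g' s t \<in> borel_measurable U\<close>)
  also have "\<dots> = prob (A \<inter> (wiener g g' s t -` B \<inter> space Q)) / prob A"
    unfolding U_def using B \<open>0 < prob A\<close> by (subst measure_uniform_measure) (auto simp: emeasure_eq_measure)
  finally show ?thesis using \<open>0 < prob A\<close> by (simp add: v_def)
qed

lemma distr_wiener:
  assumes "C1_on g g' {s..t}" "0 \<le> s" "s \<le> t"
  shows "distr Q borel (wiener g g' s t) = gaussian (integral {s..t} (\<lambda>x. (g x)\<^sup>2))"
proof -
  interpret G: real_distribution "gaussian (integral {s..t} (\<lambda>x. (g x)\<^sup>2))"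
    by (rule real_distribution_gaussian)
  have [measurable]: "wiener g g' s t \<in> borel_measurable Q"
    by (rule measurable_F[OF measurable_F_wiener[OF assms]])
  show ?thesis
  proof (rule measure_eqI)
    fix B assume "B \<in> sets (distr Q borel (wiener g g' s t))"
    then have B: "B \<in> sets borel" by simp
    have "space Q \<in> sets (F s)" using sets.top[of "F s"] by simp
    from prob_wiener_on_event[OF assms this B] B
    show "emeasure (distr Q borel (wiener g g' s t)) B
        = emeasure (gaussian (integral {s..t} (\<lambda>x. (g x)\<^sup>2))) B"
      by (simp add: emeasure_distr emeasure_eq_measure G.emeasure_eq_measure prob_space Int_absorb1)
  qed simp
qed

lemma indep_var_F_wiener:
  assumes g: "C1_on g g' {s..t}" and st: "0 \<le> s" "s \<le> t" and Y: "Y \<in> measurable (F s) N"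
  shows "indep_var N Y borel (wiener g g' s t)"
proof -
  have [measurable]: "wiener g g' s t \<in> borel_measurable Q"
    by (rule measurable_F[OF measurable_F_wiener[OF g st]])
  let ?B = "{wiener g g' s t -` B \<inter> space Q | B. B \<in> sets borel}"
  have "indep_set (sets (F s)) ?B"
  proof (rule indep_setI)
    show "sets (F s) \<subseteq> events" using sets_F by auto
    show "?B \<subseteq> events" by (auto intro: measurable_sets)
    fix A C assume A: "A \<in> sets (F s)" and "C \<in> ?B"
    then obtain B where B: "B \<in> sets borel" and C: "C = wiener g g' s t -` B \<inter> space Q" by auto
    have "space Q \<in> sets (F s)" using sets.top[of "F s"] by simp
    from prob_wiener_on_event[OF g st this B] prob_wiener_on_event[OF g st A B]
    show "prob (A \<inter> C) = prob A * prob C" by (simp add: C prob_space Int_absorb1)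
  qed
  then show ?thesis
    by (rule indep_var_from_indep_set) (use Y measurable_F measurable_sets[OF Y] in auto)
qed

lemma
  assumes g: "C1_on g g' {s..t}" and st: "0 \<le> s" "s \<le> t"
  shows integrable_wiener: "integrable Q (wiener g g' s t)" (is ?A)
    and integrable_wiener_square: "integrable Q (\<lambda>\<omega>. (wiener g g' s t \<omega>)\<^sup>2)" (is ?B)
    and expectation_wiener: "expectation (wiener g g' s t) = 0" (is ?C)
    and expectation_wiener_square:
      "expectation (\<lambda>\<omega>. (wiener g g' s t \<omega>)\<^sup>2) = integral {s..t} (\<lambda>x. (g x)\<^sup>2)" (is ?D)
    and integrable_exp_wiener: "integrable Q (\<lambda>\<omega>. exp (c * wiener g g' s t \<omega>))" (is ?E)
    and expectation_exp_wiener: "expectation (\<lambda>\<omega>. exp (c * wiener g g' s t \<omega>))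
      = exp (c\<^sup>2 * integral {s..t} (\<lambda>x. (g x)\<^sup>2) / 2)" (is ?F)
proof -
  let ?v = "integral {s..t} (\<lambda>x. (g x)\<^sup>2)"
  have X[measurable]: "wiener g g' s t \<in> borel_measurable Q"
    by (rule measurable_F[OF measurable_F_wiener[OF g st]])
  note d = distr_wiener[OF g st]
  note v = integral_square_nonneg[OF g]
  show ?A using integrable_gaussian_id[of ?v] unfolding d[symmetric]
    by (subst (asm) integrable_distr_eq) auto
  show ?B using integrable_gaussian_square[of ?v] unfolding d[symmetric]
    by (subst (asm) integrable_distr_eq) auto
  show ?C using integral_gaussian_id[of ?v] unfolding d[symmetric]
    by (subst (asm) integral_distr) auto
  show ?D using integral_gaussian_square[OF v] unfolding d[symmetric]
    by (subst (asm) integral_distr) auto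
  show ?E using integrable_gaussian_exp[of ?v c] unfolding d[symmetric]
    by (subst (asm) integrable_distr_eq) auto
  show ?F using integral_gaussian_exp[OF v, of c] unfolding d[symmetric]
    by (subst (asm) integral_distr) auto
qed

end

section \<open>Ito integrals of deterministic integrands\<close>

context complete_brownian
begin

text \<open>Moments against variables known at time \<open>s\<close>: first and second moments serve the isometry, the
  exponential one the bond price.\<close>
lemma
  fixes Y :: "'a \<Rightarrow> real"
  assumes g: "C1_on g g' {s..t}" and st: "0 \<le> s" "s \<le> t"
    and Y: "Y \<in> borel_measurable (F s)" "integrable Q Y"
  shows integrable_times_wiener: "integrable Q (\<lambda>\<omega>. Y \<omega> * wiener g g' s t \<omega>)" (is ?A)
    and expectation_times_wiener: "expectation (\<lambda>\<omega>. Y \<omega> * wiener g g' s t \<omega>) = 0" (is ?B)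
    and integrable_times_wiener_square: "integrable Q (\<lambda>\<omega>. Y \<omega> * (wiener g g' s t \<omega>)\<^sup>2)" (is ?C)
    and expectation_times_wiener_square: "expectation (\<lambda>\<omega>. Y \<omega> * (wiener g g' s t \<omega>)\<^sup>2)
      = expectation Y * integral {s..t} (\<lambda>x. (g x)\<^sup>2)" (is ?D)
    and expectation_times_exp_wiener: "expectation (\<lambda>\<omega>. Y \<omega> * exp (c * wiener g g' s t \<omega>))
      = expectation Y * exp (c\<^sup>2 * integral {s..t} (\<lambda>x. (g x)\<^sup>2) / 2)" (is ?E)
    and integrable_times_exp_wiener:
      "integrable Q (\<lambda>\<omega>. Y \<omega> * exp (c * wiener g g' s t \<omega>))" (is ?F)
proof -
  have ind: "indep_var borel Y borel (wiener g g' s t)"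
    using g st Y(1) by (rule indep_var_F_wiener)
  have ind_comp: "indep_var borel Y borel (\<lambda>\<omega>. f (wiener g g' s t \<omega>))" if "f \<in> borel_measurable borel" for f :: "real \<Rightarrow> real"
    using indep_var_compose[OF ind measurable_ident that] by (simp add: comp_def)
  have ind2: "indep_var borel Y borel (\<lambda>\<omega>. (wiener g g' s t \<omega>)\<^sup>2)"
    by (rule ind_comp) simp
  have ind3: "indep_var borel Y borel (\<lambda>\<omega>. exp (c * wiener g g' s t \<omega>))"
    by (rule ind_comp) simp
  show ?A using ind Y(2) integrable_wiener[OF g st] by (rule indep_var_integrable)
  show ?B using indep_var_lebesgue_integral[OF ind Y(2) integrable_wiener[OF g st]]
    by (simp add: expectation_wiener[OF g st])
  show ?C using ind2 Y(2) integrable_wiener_square[OF g st] by (rule indep_var_integrable)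
  show ?D using indep_var_lebesgue_integral[OF ind2 Y(2) integrable_wiener_square[OF g st]]
    by (simp add: expectation_wiener_square[OF g st])
  show ?E using indep_var_lebesgue_integral[OF ind3 Y(2) integrable_exp_wiener[OF g st]]
    by (simp add: expectation_exp_wiener[OF g st])
  show ?F using ind3 Y(2) integrable_exp_wiener[OF g st] by (rule indep_var_integrable)
qed

lemma wiener_one: "wiener (\<lambda>x. 1) (\<lambda>x. 0) s t \<omega> = W t \<omega> - W s \<omega>"
  by (simp add: wiener_def parts_integral_one)

lemma integrable_bounded_measurable_F:
  fixes \<xi> :: "'a \<Rightarrow> real"
  assumes "\<xi> \<in> borel_measurable (F s)" "bounded (\<xi> ` space Q)"
  shows "integrable Q \<xi>"
proof -
  obtain K where "\<And>\<omega>. \<omega> \<in> space Q \<Longrightarrow> \<bar>\<xi> \<omega>\<bar> \<le> K"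
    using assms(2) unfolding bounded_iff by auto
  then show ?thesis
    using measurable_F[OF assms(1)] by (intro integrable_const_bound[where B=K]) auto
qed

text \<open>The isometry on one cell, for the difference between the elementary integral and \<open>\<integral> g dW\<close>, and
  the orthogonality of this difference to the past. Comparing with \<open>\<integral> g dW\<close> directly, rather than
  with a step function approximating \<open>g\<close>, makes common refinements of partitions unnecessary.\<close>
lemma
  fixes \<xi> :: "'a \<Rightarrow> real"
  assumes g: "C1_on g g' {s..t}" and st: "0 \<le> s" "s \<le> t"
    and \<xi>: "\<xi> \<in> borel_measurable (F s)" "bounded (\<xi> ` space Q)"
  defines "D \<equiv> \<lambda>\<omega>. \<xi> \<omega> * (W t \<omega> - W s \<omega>) - wiener g g' s t \<omega>"
  shows measurable_F_step_error: "D \<in> borel_measurable (F t)" (is ?A)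
    and integrable_step_error_square: "integrable Q (\<lambda>\<omega>. (D \<omega>)\<^sup>2)" (is ?B)
    and integrable_step_integral: "integrable Q (\<lambda>\<omega>. integral {s..t} (\<lambda>x. (\<xi> \<omega> - g x)\<^sup>2))" (is ?C)
    and expectation_step_error_square: "expectation (\<lambda>\<omega>. (D \<omega>)\<^sup>2)
      = expectation (\<lambda>\<omega>. integral {s..t} (\<lambda>x. (\<xi> \<omega> - g x)\<^sup>2))" (is ?E)
    and step_error_orthogonal: "\<And>M. M \<in> borel_measurable (F s) \<Longrightarrow> integrable Q M \<Longrightarrow>
      integrable Q (\<lambda>\<omega>. M \<omega> * D \<omega>) \<and> expectation (\<lambda>\<omega>. M \<omega> * D \<omega>) = 0"
proof -
  let ?v = "integral {s..t} (\<lambda>x. (g x)\<^sup>2)" and ?v1 = "integral {s..t} (\<lambda>x. (1 + g x)\<^sup>2)"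
  have one: "C1_on (\<lambda>x. 1) (\<lambda>x. 0) {s..t}" by (rule C1_on_const)
  have g1: "C1_on (\<lambda>x. 1 + g x) (\<lambda>x. 0 + g' x) {s..t}" using one g by (rule C1_on_add)
  have [measurable]: "W s \<in> borel_measurable (F t)" "W t \<in> borel_measurable (F t)"
    using st by (auto intro: measurable_F_W)
  have \<xi>t[measurable]: "\<xi> \<in> borel_measurable (F t)" using F_mono[OF st(2) \<xi>(1)] .
  have Nt[measurable]: "wiener g g' s t \<in> borel_measurable (F t)" by (rule measurable_F_wiener[OF g st])
  show D: ?A unfolding D_def by measurable
  note \<xi>i = integrable_bounded_measurable_F[OF \<xi>]
  obtain K where K: "\<And>\<omega>. \<omega> \<in> space Q \<Longrightarrow> \<bar>\<xi> \<omega>\<bar> \<le> K"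
    using \<xi>(2) unfolding bounded_iff by auto
  have sq: "(\<lambda>\<omega>. (\<xi> \<omega>)\<^sup>2) \<in> borel_measurable (F s)" using \<xi>(1) by measurable
  have sqb: "bounded ((\<lambda>\<omega>. (\<xi> \<omega>)\<^sup>2) ` space Q)"
    unfolding bounded_iff using K by (auto intro!: exI[of _ "K\<^sup>2"] abs_le_square_iff[THEN iffD1] order_trans[OF _ abs_ge_self])
  note sqi = integrable_bounded_measurable_F[OF sq sqb]
  \<comment> \<open>The expansion of the square of \<open>D\<close>, with the mixed term \<open>2 * \<Delta>W * \<integral> g dW\<close> polarized: it is the
    square of the integral of \<open>1 + g\<close> minus the squares of both factors.\<close>
  define T where "T \<omega> = (\<xi> \<omega>)\<^sup>2 * (wiener (\<lambda>x. 1) (\<lambda>x. 0) s t \<omega>)\<^sup>2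
      - (\<xi> \<omega> * (wiener (\<lambda>x. 1 + g x) (\<lambda>x. 0 + g' x) s t \<omega>)\<^sup>2
         - \<xi> \<omega> * (wiener (\<lambda>x. 1) (\<lambda>x. 0) s t \<omega>)\<^sup>2 - \<xi> \<omega> * (wiener g g' s t \<omega>)\<^sup>2)
      + (wiener g g' s t \<omega>)\<^sup>2" for \<omega>
  note i = integrable_times_wiener_square[OF one st sq sqi] integrable_times_wiener_square[OF g1 st \<xi>(1) \<xi>i]
    integrable_times_wiener_square[OF one st \<xi>(1) \<xi>i] integrable_times_wiener_square[OF g st \<xi>(1) \<xi>i]
    integrable_wiener_square[OF g st]
  note e = expectation_times_wiener_square[OF one st sq sqi] expectation_times_wiener_square[OF g1 st \<xi>(1) \<xi>i]
    expectation_times_wiener_square[OF one st \<xi>(1) \<xi>i] expectation_times_wiener_square[OF g st \<xi>(1) \<xi>i]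
    expectation_wiener_square[OF g st]
  have Ti: "integrable Q T" unfolding T_def
    by (intro Bochner_Integration.integrable_add Bochner_Integration.integrable_diff i)
  have "expectation T = expectation (\<lambda>\<omega>. (\<xi> \<omega>)\<^sup>2) * (t - s)
    - (expectation \<xi> * ?v1 - expectation \<xi> * (t - s) - expectation \<xi> * ?v) + ?v"
    unfolding T_def using st
    by (simp add: i e del: add_0)
  have DT: "AE \<omega> in Q. (D \<omega>)\<^sup>2 = T \<omega>"
    using AE_continuous_W_Icc[OF st(1), of t]
  proof eventually_elim
    case (elim \<omega>)
    have "wiener (\<lambda>x. 1 + g x) (\<lambda>x. 0 + g' x) s t \<omega> = wiener (\<lambda>x. 1) (\<lambda>x. 0) s t \<omega> + wiener g g' s t \<omega>"
      unfolding wiener_def by (rule parts_integral_add[OF one g elim])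
    then show ?case unfolding T_def D_def wiener_one[symmetric]
      by (simp only:) (simp add: power2_eq_square algebra_simps)
  qed
  have Dm: "(\<lambda>\<omega>. (D \<omega>)\<^sup>2) \<in> borel_measurable Q"
    using measurable_F[OF D] by measurable
  have Tm: "T \<in> borel_measurable Q" using Ti by simp
  show ?B using integrable_cong_AE[OF Dm Tm DT] Ti by simp
  have id: "integral {s..t} (\<lambda>x. (\<xi> \<omega> - g x)\<^sup>2)
    = (\<xi> \<omega>)\<^sup>2 * (t - s) - \<xi> \<omega> * (?v1 - (t - s) - ?v) + ?v" for \<omega>
    by (rule integral_square_diff[OF g st(2)])
  show ?C unfolding id using \<xi>i sqi by simp
  have "expectation (\<lambda>\<omega>. integral {s..t} (\<lambda>x. (\<xi> \<omega> - g x)\<^sup>2))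
    = expectation (\<lambda>\<omega>. (\<xi> \<omega>)\<^sup>2) * (t - s) - expectation \<xi> * (?v1 - (t - s) - ?v) + ?v"
    unfolding id using \<xi>i sqi by (simp add: prob_space)
  also have "\<dots> = expectation T"
    using \<open>expectation T = _\<close> by (simp add: algebra_simps)
  also have "\<dots> = expectation (\<lambda>\<omega>. (D \<omega>)\<^sup>2)" using integral_cong_AE[OF Dm Tm DT] by simp
  finally show ?E by simp
  fix M :: "'a \<Rightarrow> real" assume M: "M \<in> borel_measurable (F s)" "integrable Q M"
  have M\<xi>: "(\<lambda>\<omega>. M \<omega> * \<xi> \<omega>) \<in> borel_measurable (F s)" using M \<xi>(1) by measurable
  have M\<xi>i: "integrable Q (\<lambda>\<omega>. M \<omega> * \<xi> \<omega>)"
  proof (rule Bochner_Integration.integrable_bound)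
    show "integrable Q (\<lambda>\<omega>. K * M \<omega>)" using M by simp
    show "AE \<omega> in Q. norm (M \<omega> * \<xi> \<omega>) \<le> norm (K * M \<omega>)"
    proof (rule AE_I2)
      fix \<omega> assume "\<omega> \<in> space Q"
      then have "\<bar>\<xi> \<omega>\<bar> \<le> \<bar>K\<bar>" using K[of \<omega>] by linarith
      then have "\<bar>M \<omega>\<bar> * \<bar>\<xi> \<omega>\<bar> \<le> \<bar>M \<omega>\<bar> * \<bar>K\<bar>" by (rule mult_left_mono) simp
      then show "norm (M \<omega> * \<xi> \<omega>) \<le> norm (K * M \<omega>)" by (simp add: abs_mult mult.commute)
    qed
  qed (rule measurable_F[OF M\<xi>])
  have eq: "M \<omega> * D \<omega> = (M \<omega> * \<xi> \<omega>) * wiener (\<lambda>x. 1) (\<lambda>x. 0) s t \<omega> - M \<omega> * wiener g g' s t \<omega>" for \<omega>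
    by (simp add: D_def wiener_one algebra_simps)
  show "integrable Q (\<lambda>\<omega>. M \<omega> * D \<omega>) \<and> expectation (\<lambda>\<omega>. M \<omega> * D \<omega>) = 0"
    unfolding eq
    using integrable_times_wiener[OF one st M\<xi> M\<xi>i] expectation_times_wiener[OF one st M\<xi> M\<xi>i]
      integrable_times_wiener[OF g st M] expectation_times_wiener[OF g st M] by simp
qed

text \<open>Orthogonal increments: the mixed terms of the square of the sum vanish.\<close>
lemma
  assumes g: "C1_on g g' {x 0..T}" and x0: "0 \<le> x 0"
    and x: "\<And>k. k < N \<Longrightarrow> x k \<le> x (Suc k)" and xN: "x N \<le> T"
    and \<xi>: "\<And>k. k < N \<Longrightarrow> \<xi> k \<in> borel_measurable (F (x k))" "\<And>k. k < N \<Longrightarrow> bounded (\<xi> k ` space Q)"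
  defines "M \<equiv> \<lambda>\<omega>. \<Sum>k<N. \<xi> k \<omega> * (W (x (Suc k)) \<omega> - W (x k) \<omega>) - wiener g g' (x k) (x (Suc k)) \<omega>"
  shows integrable_sum_error_square: "integrable Q (\<lambda>\<omega>. (M \<omega>)\<^sup>2)"
    and integrable_sum_integral:
      "integrable Q (\<lambda>\<omega>. \<Sum>k<N. integral {x k..x (Suc k)} (\<lambda>s. (\<xi> k \<omega> - g s)\<^sup>2))"
    and expectation_sum_error_square: "expectation (\<lambda>\<omega>. (M \<omega>)\<^sup>2)
      = expectation (\<lambda>\<omega>. \<Sum>k<N. integral {x k..x (Suc k)} (\<lambda>s. (\<xi> k \<omega> - g s)\<^sup>2))"
proof -
  define D where "D k \<omega> = \<xi> k \<omega> * (W (x (Suc k)) \<omega> - W (x k) \<omega>) - wiener g g' (x k) (x (Suc k)) \<omega>" for k \<omega>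
  define I where "I k \<omega> = integral {x k..x (Suc k)} (\<lambda>s. (\<xi> k \<omega> - g s)\<^sup>2)" for k \<omega>
  have mono: "x i \<le> x j" if "i \<le> j" "j \<le> N" for i j
    using that by (induction j) (use x in \<open>auto simp: le_Suc_eq intro: order_trans\<close>)
  have pos: "0 \<le> x i" if "i \<le> N" for i using mono[of 0 i] that x0 by auto
  have gk: "C1_on g g' {x k..x (Suc k)}" if "k < N" for k
    using mono[of 0 k] mono[of "Suc k" N] xN that by (intro C1_on_subset[OF g]) auto
  note step = measurable_F_step_error integrable_step_error_square integrable_step_integral
    expectation_step_error_square step_error_orthogonal
  have Dk: "D k \<in> borel_measurable (F (x (Suc k)))" "integrable Q (\<lambda>\<omega>. (D k \<omega>)\<^sup>2)" "integrable Q (I k)"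
      "expectation (\<lambda>\<omega>. (D k \<omega>)\<^sup>2) = expectation (I k)"
      "\<And>M. M \<in> borel_measurable (F (x k)) \<Longrightarrow> integrable Q M \<Longrightarrow>
        integrable Q (\<lambda>\<omega>. M \<omega> * D k \<omega>) \<and> expectation (\<lambda>\<omega>. M \<omega> * D k \<omega>) = 0" if "k < N" for k
    unfolding D_def I_def
    using step[OF gk[OF that] pos[OF less_imp_le[OF that]] x[OF that] \<xi>(1)[OF that] \<xi>(2)[OF that]]
    by auto
  have main: "(\<lambda>\<omega>. \<Sum>k<n. D k \<omega>) \<in> borel_measurable (F (x n)) \<and> integrable Q (\<lambda>\<omega>. (\<Sum>k<n. D k \<omega>)\<^sup>2) \<and>
     integrable Q (\<lambda>\<omega>. \<Sum>k<n. I k \<omega>) \<and>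
     expectation (\<lambda>\<omega>. (\<Sum>k<n. D k \<omega>)\<^sup>2) = expectation (\<lambda>\<omega>. \<Sum>k<n. I k \<omega>)" if "n \<le> N" for n
    using that
  proof (induction n)
    case (Suc n)
    let ?S = "\<lambda>\<omega>. \<Sum>k<n. D k \<omega>"
    have n: "n < N" using Suc.prems by simp
    have S: "?S \<in> borel_measurable (F (x n))" "integrable Q (\<lambda>\<omega>. (?S \<omega>)\<^sup>2)" "integrable Q (\<lambda>\<omega>. \<Sum>k<n. I k \<omega>)"
      "expectation (\<lambda>\<omega>. (?S \<omega>)\<^sup>2) = expectation (\<lambda>\<omega>. \<Sum>k<n. I k \<omega>)"
      using Suc by auto
    have Si: "integrable Q ?S"
      using measurable_F[OF S(1)] S(2) by (rule square_integrable_imp_integrable)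
    note SD = Dk(5)[OF n S(1) Si]
    have eq: "(\<Sum>k<Suc n. D k \<omega>)\<^sup>2 = (?S \<omega>)\<^sup>2 + 2 * (?S \<omega> * D n \<omega>) + (D n \<omega>)\<^sup>2" for \<omega>
      by (simp add: power2_eq_square algebra_simps)
    show ?case
    proof (intro conjI)
      show "(\<lambda>\<omega>. \<Sum>k<Suc n. D k \<omega>) \<in> borel_measurable (F (x (Suc n)))"
        using F_mono[OF x[OF n] S(1)] Dk(1)[OF n] by simp
      show "integrable Q (\<lambda>\<omega>. (\<Sum>k<Suc n. D k \<omega>)\<^sup>2)"
        unfolding eq using S SD Dk(2)[OF n] by simp
      show "integrable Q (\<lambda>\<omega>. \<Sum>k<Suc n. I k \<omega>)" using S Dk(3)[OF n] by simp
      show "expectation (\<lambda>\<omega>. (\<Sum>k<Suc n. D k \<omega>)\<^sup>2) = expectation (\<lambda>\<omega>. \<Sum>k<Suc n. I k \<omega>)"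
        unfolding eq using S SD Dk(2,3,4)[OF n] by simp
    qed
  qed simp
  show "integrable Q (\<lambda>\<omega>. (M \<omega>)\<^sup>2)"
     "integrable Q (\<lambda>\<omega>. \<Sum>k<N. integral {x k..x (Suc k)} (\<lambda>s. (\<xi> k \<omega> - g s)\<^sup>2))"
     "expectation (\<lambda>\<omega>. (M \<omega>)\<^sup>2)
      = expectation (\<lambda>\<omega>. \<Sum>k<N. integral {x k..x (Suc k)} (\<lambda>s. (\<xi> k \<omega> - g s)\<^sup>2))"
    using main[of N] unfolding M_def D_def I_def by auto
qed

end

lemma has_integral_pieces:
  fixes h :: "real \<Rightarrow> real"
  assumes x: "\<And>k. k < N \<Longrightarrow> x k \<le> x (Suc k)"
    and h: "\<And>k. k < N \<Longrightarrow> (h has_integral I k) {x k..x (Suc k)}"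
  shows "(h has_integral (\<Sum>k<N. I k)) {x 0..x N}"
  using assms
proof (induction N)
  case (Suc N)
  have "x 0 \<le> x M" if "M \<le> N" for M
    using that by (induction M) (use Suc.prems in \<open>auto intro: order_trans\<close>)
  then show ?case
    using Suc by (auto intro: has_integral_combine[of "x 0" "x N" "x (Suc N)"])
next
  case 0
  show ?case using has_integral_refl(2)[of h "x 0"] by simp
qed

lemma simple_process_on_cell:
  assumes ts: "\<And>i. i < n \<Longrightarrow> ts i < ts (Suc i)" and j: "j < n" and s: "ts j < s" "s \<le> ts (Suc j)"
  shows "simple_process n ts \<xi> s \<omega> = \<xi> j \<omega>"
proof -
  have mono: "ts i \<le> ts k" if "i \<le> k" "k \<le> n" for i k
    using that by (induction k) (auto simp: le_Suc_eq Suc_le_eq intro: order_trans less_imp_le[OF ts])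
  have "indicator {ts i<..ts (Suc i)} s = (0::real)" if "i < n" "i \<noteq> j" for i
    using mono[of "Suc i" j] mono[of "Suc j" i] that s j by (cases "i < j") (auto simp: indicator_def)
  then have "simple_process n ts \<xi> s \<omega> = (\<Sum>i<n. if i = j then \<xi> j \<omega> else 0)"
    unfolding simple_process_def using s by (intro sum.cong) auto
  then show ?thesis using j by simp
qed

lemma simple_process_outside:
  assumes ts: "\<And>i. i < n \<Longrightarrow> ts i < ts (Suc i)" and s: "s \<le> ts 0 \<or> ts n < s"
  shows "simple_process n ts \<xi> s \<omega> = 0"
proof -
  have mono: "ts i \<le> ts k" if "i \<le> k" "k \<le> n" for i k
    using that by (induction k) (auto simp: le_Suc_eq Suc_le_eq intro: order_trans less_imp_le[OF ts])
  have "indicator {ts i<..ts (Suc i)} s = (0::real)" if "i < n" for i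
    using mono[of 0 i] mono[of "Suc i" n] that s by (auto simp: indicator_def)
  then show ?thesis unfolding simple_process_def by simp
qed

context complete_brownian
begin

text \<open>The partition of the simple integrand is cut off at \<open>t\<close> and completed by \<open>0\<close> and \<open>t\<close>, on whose
  additional cells the integrand vanishes; then the isometry on partitions applies.\<close>
lemma ito_isometry:
  assumes simple: "simple_integrand Q F n ts \<xi>" and g: "C1_on g g' {0..t}" and t: "0 \<le> t"
  shows "(\<integral>\<^sup>+\<omega>. ennreal ((simple_integral W n ts \<xi> t \<omega> - wiener g g' 0 t \<omega>)\<^sup>2) \<partial>Q)
    = (\<integral>\<^sup>+\<omega>. (\<integral>\<^sup>+s\<in>{0..t}. ennreal ((simple_process n ts \<xi> s \<omega> - g s)\<^sup>2) \<partial>lborel) \<partial>Q)"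
proof -
  have ts0: "0 \<le> ts 0" and ts: "\<And>i. i < n \<Longrightarrow> ts i < ts (Suc i)"
    and \<xi>: "\<And>i. i < n \<Longrightarrow> \<xi> i \<in> borel_measurable (F (ts i))" "\<And>i. i < n \<Longrightarrow> bounded (\<xi> i ` space Q)"
    using simple by (auto simp: simple_integrand_def)
  define x where "x k = (case k of 0 \<Rightarrow> 0 | Suc i \<Rightarrow> if i \<le> n then min (ts i) t else t)" for k
  \<comment> \<open>Coefficients whose cell starts at or after \<open>t\<close> are replaced by zero: such a cell is cut off to
    length zero, and its coefficient need not be known at time \<open>t\<close>.\<close>
  define \<eta> where "\<eta> k = (case k of 0 \<Rightarrow> \<lambda>\<omega>. 0
    | Suc i \<Rightarrow> if i < n \<and> ts i < t then \<xi> i else (\<lambda>\<omega>. 0))" for k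
  define N where "N = Suc (Suc n)"
  have tspos: "0 \<le> ts i" if "i \<le> n" for i
    using that by (induction i) (use ts0 ts in \<open>force simp: Suc_le_eq\<close>)+
  have x0: "x 0 = 0" and xN: "x N = t" by (simp_all add: x_def N_def)
  have x: "x k \<le> x (Suc k)" for k
    using ts[of "k - 1"] tspos t ts0 by (cases k) (auto simp: x_def)
  have \<eta>m: "\<eta> k \<in> borel_measurable (F (x k))" "bounded (\<eta> k ` space Q)" for k
  proof -
    have "\<eta> k = (\<lambda>\<omega>. 0) \<or> (\<exists>i<n. \<eta> k = \<xi> i \<and> x k = ts i)"
      by (cases k) (auto simp: \<eta>_def x_def)
    moreover have "bounded ((\<lambda>\<omega>. 0::real) ` space Q)" by (auto simp: bounded_iff intro!: exI[of _ 0])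
    ultimately show "\<eta> k \<in> borel_measurable (F (x k))" "bounded (\<eta> k ` space Q)"
      using \<xi> by auto
  qed
  define M where "M \<omega> = (\<Sum>k<N. \<eta> k \<omega> * (W (x (Suc k)) \<omega> - W (x k) \<omega>) - wiener g g' (x k) (x (Suc k)) \<omega>)" for \<omega>
  define I where "I k \<omega> = integral {x k..x (Suc k)} (\<lambda>s. (\<eta> k \<omega> - g s)\<^sup>2)" for k \<omega>
  have gx: "C1_on g g' {x 0..t}" using g by (simp add: x0)
  note err = integrable_sum_error_square[where N=N and x=x and \<xi>=\<eta>, OF gx, folded M_def]
    integrable_sum_integral[where N=N and x=x and \<xi>=\<eta>, OF gx, folded I_def]
    expectation_sum_error_square[where N=N and x=x and \<xi>=\<eta>, OF gx, folded M_def I_def]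
  have Mi: "integrable Q (\<lambda>\<omega>. (M \<omega>)\<^sup>2)" and Ii: "integrable Q (\<lambda>\<omega>. \<Sum>k<N. I k \<omega>)"
    and eq: "expectation (\<lambda>\<omega>. (M \<omega>)\<^sup>2) = expectation (\<lambda>\<omega>. \<Sum>k<N. I k \<omega>)"
    using err x \<eta>m x0 xN by auto
  have xin: "{x k..x (Suc k)} \<subseteq> {0..t}" if "k < N" for k
  proof -
    have "x i \<le> t" for i by (auto simp: x_def t split: nat.split)
    moreover have "0 \<le> x i" for i by (auto simp: x_def t tspos split: nat.split)
    ultimately show ?thesis by (meson atLeastatMost_subset_iff)
  qed
  have cg: "continuous_on {0..t} g" using g by (rule C1_on_continuous)
  have Ipos: "0 \<le> (\<Sum>k<N. I k \<omega>)" for \<omega>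
    unfolding I_def
  proof (intro sum_nonneg integral_nonneg integrable_continuous_real continuous_intros)
    show "continuous_on {x k..x (Suc k)} g" if "k \<in> {..<N}" for k
      using continuous_on_subset[OF cg xin] that by simp
  qed simp
  have MI: "M \<omega> = simple_integral W n ts \<xi> t \<omega> - wiener g g' 0 t \<omega>"
    if cont: "continuous_on {0..t} (\<lambda>x. W x \<omega>)" for \<omega>
  proof -
    have "(\<Sum>k<N. wiener g g' (x k) (x (Suc k)) \<omega>) = wiener g g' 0 t \<omega>"
      unfolding wiener_def using parts_integral_sum[OF g cont, of N x] x x0 xN by simp
    moreover have "(\<Sum>k<N. \<eta> k \<omega> * (W (x (Suc k)) \<omega> - W (x k) \<omega>)) = simple_integral W n ts \<xi> t \<omega>"
    proof -
      have "(\<Sum>k<N. \<eta> k \<omega> * (W (x (Suc k)) \<omega> - W (x k) \<omega>))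
          = (\<Sum>k<n. \<eta> (Suc k) \<omega> * (W (x (Suc (Suc k))) \<omega> - W (x (Suc k)) \<omega>))"
        unfolding N_def by (subst sum.lessThan_Suc, subst sum.lessThan_Suc_shift) (simp add: \<eta>_def)
      also have "\<dots> = simple_integral W n ts \<xi> t \<omega>"
        unfolding simple_integral_def
      proof (rule sum.cong)
        fix k assume "k \<in> {..<n}"
        then show "\<eta> (Suc k) \<omega> * (W (x (Suc (Suc k))) \<omega> - W (x (Suc k)) \<omega>)
            = \<xi> k \<omega> * (W (min (ts (Suc k)) t) \<omega> - W (min (ts k) t) \<omega>)"
          using ts[of k] by (auto simp: \<eta>_def x_def min_def)
      qed simp
      finally show ?thesis .
    qed
    ultimately show ?thesis by (simp add: M_def sum_subtractf)
  qed
  have path: "(\<integral>\<^sup>+s\<in>{0..t}. ennreal ((simple_process n ts \<xi> s \<omega> - g s)\<^sup>2) \<partial>lborel) = ennreal (\<Sum>k<N. I k \<omega>)" for \<omega>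
  proof -
    let ?h = "\<lambda>s. (simple_process n ts \<xi> s \<omega> - g s)\<^sup>2"
    have cell: "simple_process n ts \<xi> s \<omega> = \<eta> k \<omega>" if k: "k < N" and s: "x k < s" "s \<le> x (Suc k)" for k s
    proof (cases k)
      case 0
      with s have "s \<le> ts 0" by (simp add: x_def)
      with 0 show ?thesis using simple_process_outside[where n=n and ts=ts and s=s, OF ts] by (simp add: \<eta>_def)
    next
      case (Suc i)
      show ?thesis
      proof (cases "i < n")
        case True
        with Suc s have "ts i < s" "s \<le> ts (Suc i)" "ts i < t" by (auto simp: x_def min_def split: if_splits)
        then show ?thesis using simple_process_on_cell[where n=n and ts=ts and s=s and j=i, OF ts] True Suc by (simp add: \<eta>_def)
      next
        case False
        with Suc k have "i = n" by (simp add: N_def)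
        with Suc s have "ts n < s" by (auto simp: x_def min_def split: if_splits)
        then show ?thesis using simple_process_outside[where n=n and ts=ts and s=s, OF ts] False Suc by (simp add: \<eta>_def)
      qed
    qed
    have "(?h has_integral (\<Sum>k<N. I k \<omega>)) {x 0..x N}"
    proof (rule has_integral_pieces)
      fix k assume k: "k < N"
      show "(?h has_integral I k \<omega>) {x k..x (Suc k)}"
      proof (rule has_integral_spike_finite)
        show "finite {x k}" by simp
        show "?h s = (\<eta> k \<omega> - g s)\<^sup>2" if "s \<in> {x k..x (Suc k)} - {x k}" for s
          using cell[OF k, of s] that by auto
        show "((\<lambda>s. (\<eta> k \<omega> - g s)\<^sup>2) has_integral I k \<omega>) {x k..x (Suc k)}"
          unfolding I_def using continuous_on_subset[OF cg xin[OF k]]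
          by (intro integrable_integral integrable_continuous_real continuous_intros)
      qed
    qed (rule x)
    then have "((\<lambda>s. if s \<in> {0..t} then ?h s else 0) has_integral (\<Sum>k<N. I k \<omega>)) UNIV"
      unfolding x0 xN by (simp only: has_integral_restrict_UNIV)
    moreover have "(\<lambda>s. if s \<in> {0..t} then ?h s else 0) = (\<lambda>s. indicator {0..t} s * ?h s)"
      by (auto simp: indicator_def)
    ultimately have "((\<lambda>s. indicator {0..t} s * ?h s) has_integral (\<Sum>k<N. I k \<omega>)) UNIV" by simp
    moreover have "(\<lambda>s. indicator {0..t} s * ?h s) \<in> borel_measurable borel"
    proof -
      have [measurable]: "(\<lambda>s. indicator {0..t} s * g s) \<in> borel_measurable borel"
        using borel_measurable_continuous_on_indicator[OF _ cg] by simp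
      have "(\<lambda>s. (indicator {0..t} s * simple_process n ts \<xi> s \<omega> - indicator {0..t} s * g s)\<^sup>2) \<in> borel_measurable borel"
        unfolding simple_process_def by measurable
      also have "(\<lambda>s. (indicator {0..t} s * simple_process n ts \<xi> s \<omega> - indicator {0..t} s * g s)\<^sup>2)
        = (\<lambda>s. indicator {0..t} s * ?h s)" by (auto simp: indicator_def)
      finally show ?thesis .
    qed
    ultimately have "(\<integral>\<^sup>+s. ennreal (indicator {0..t} s * ?h s) \<partial>lborel) = ennreal (\<Sum>k<N. I k \<omega>)"
      by (intro nn_integral_has_integral_lborel) auto
    moreover have "(\<integral>\<^sup>+s\<in>{0..t}. ennreal (?h s) \<partial>lborel) = (\<integral>\<^sup>+s. ennreal (indicator {0..t} s * ?h s) \<partial>lborel)"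
      by (intro nn_integral_cong) (auto simp: indicator_def)
    ultimately show ?thesis by simp
  qed
  have "(\<integral>\<^sup>+\<omega>. ennreal ((simple_integral W n ts \<xi> t \<omega> - wiener g g' 0 t \<omega>)\<^sup>2) \<partial>Q) = (\<integral>\<^sup>+\<omega>. ennreal ((M \<omega>)\<^sup>2) \<partial>Q)"
    using AE_continuous_W_Icc[of 0 t] by (intro nn_integral_cong_AE) (auto elim!: eventually_mono simp: MI)
  also have "\<dots> = ennreal (expectation (\<lambda>\<omega>. \<Sum>k<N. I k \<omega>))"
    using Mi by (simp add: nn_integral_eq_integral eq)
  also have "\<dots> = (\<integral>\<^sup>+\<omega>. ennreal (\<Sum>k<N. I k \<omega>) \<partial>Q)"
    using Ii Ipos by (subst nn_integral_eq_integral) auto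
  finally show ?thesis by (simp only: path)
qed

text \<open>By the isometry the elementary integrals that converge to \<open>X\<close> in mean square also converge to
  the pathwise integral.\<close>
lemma ito_integral_deterministic:
  assumes ito: "is_ito_integral Q F W t (\<lambda>s \<omega>. g s) X" and g: "C1_on g g' {0..t}" and t: "0 \<le> t"
  shows "AE \<omega> in Q. X \<omega> = wiener g g' 0 t \<omega>"
proof -
  obtain n ts \<xi> where
    simple: "\<And>k::nat. simple_integrand Q F (n k) (ts k) (\<xi> k)" and
    a: "(\<lambda>k. \<integral>\<^sup>+\<omega>. (\<integral>\<^sup>+s\<in>{0..t}.
           ennreal ((simple_process (n k) (ts k) (\<xi> k) s \<omega> - g s)\<^sup>2) \<partial>lborel) \<partial>Q) \<longlonglongrightarrow> 0" and
    b: "(\<lambda>k. \<integral>\<^sup>+\<omega>. ennreal ((simple_integral W (n k) (ts k) (\<xi> k) t \<omega> - X \<omega>)\<^sup>2) \<partial>Q) \<longlonglongrightarrow> 0"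
    and X[measurable]: "X \<in> borel_measurable Q"
    using ito unfolding is_ito_integral_def by blast
  define S where "S k = simple_integral W (n k) (ts k) (\<xi> k) t" for k
  have [measurable]: "wiener g g' 0 t \<in> borel_measurable Q"
    by (rule measurable_F[OF measurable_F_wiener[OF g _ t]]) simp
  have [measurable]: "S k \<in> borel_measurable Q" for k
  proof -
    have "0 \<le> ts k i" if "i \<le> n k" for i
      using that by (induction i) (use simple[of k] in \<open>force simp: simple_integrand_def Suc_le_eq\<close>)+
    then have "W (min (ts k i) t) \<in> borel_measurable Q" if "i \<le> n k" for i
      using that t by (intro measurable_W) auto
    moreover have "\<xi> k i \<in> borel_measurable Q" if "i < n k" for i
      using simple[of k] that by (auto simp: simple_integrand_def intro: measurable_F)
    ultimately show ?thesis unfolding S_def simple_integral_def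
      by (intro borel_measurable_sum borel_measurable_times borel_measurable_diff) auto
  qed
  let ?A = "\<lambda>k. \<integral>\<^sup>+\<omega>. ennreal ((S k \<omega> - wiener g g' 0 t \<omega>)\<^sup>2) \<partial>Q"
  let ?B = "\<lambda>k. \<integral>\<^sup>+\<omega>. ennreal ((S k \<omega> - X \<omega>)\<^sup>2) \<partial>Q"
  let ?C = "\<integral>\<^sup>+\<omega>. ennreal ((X \<omega> - wiener g g' 0 t \<omega>)\<^sup>2) \<partial>Q"
  have A: "?A \<longlonglongrightarrow> 0" using a by (simp add: S_def ito_isometry[OF simple g t])
  have B: "?B \<longlonglongrightarrow> 0" using b by (simp add: S_def)
  have "?C \<le> 2 * ?A k + 2 * ?B k" for k
  proof -
    have "(x - y)\<^sup>2 \<le> 2 * (z - y)\<^sup>2 + 2 * (z - x)\<^sup>2" for x y z :: real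
      using zero_le_power2[of "(z - x) + (z - y)"] by (simp add: power2_eq_square algebra_simps)
    then have "?C \<le> (\<integral>\<^sup>+\<omega>. 2 * ennreal ((S k \<omega> - wiener g g' 0 t \<omega>)\<^sup>2) + 2 * ennreal ((S k \<omega> - X \<omega>)\<^sup>2) \<partial>Q)"
      by (intro nn_integral_mono)
         (simp add: ennreal_plus[symmetric] ennreal_mult[symmetric] ennreal_numeral[symmetric] ennreal_leI del: ennreal_plus ennreal_numeral)
    then show ?thesis by (simp add: nn_integral_add nn_integral_cmult)
  qed
  moreover have "(\<lambda>k. 2 * ?A k + 2 * ?B k) \<longlonglongrightarrow> 2 * 0 + 2 * 0"
    by (intro tendsto_add ennreal_tendsto_cmult A B) auto
  ultimately have "?C \<le> 2 * 0 + 2 * 0" by (intro LIMSEQ_le_const) auto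
  then have "?C = 0" by simp
  then show ?thesis by (subst (asm) nn_integral_0_iff_AE) (auto elim!: eventually_mono)
qed

end

section \<open>The driving noise along paths\<close>

text \<open>Such a process is the limit of its discretizations in time, which are jointly measurable because
  they involve only countably many times.\<close>
lemma borel_measurable_continuous_process:
  fixes f :: "real \<Rightarrow> 'a \<Rightarrow> real"
  assumes meas: "\<And>s. f s \<in> borel_measurable M"
    and cont: "\<And>\<omega>. \<omega> \<in> space M \<Longrightarrow> continuous_on UNIV (\<lambda>s. f s \<omega>)"
  shows "(\<lambda>(s, \<omega>). f s \<omega>) \<in> borel_measurable (borel \<Otimes>\<^sub>M M)"
proof (rule borel_measurable_LIMSEQ_real)
  define d where "d n s = of_int \<lfloor>real (Suc n) * s\<rfloor> / real (Suc n)" for n s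
  show "(\<lambda>(s, \<omega>). f (d n s) \<omega>) \<in> borel_measurable (borel \<Otimes>\<^sub>M M)" for n
  proof -
    have "(\<lambda>x. f (of_int i / real (Suc n)) (snd x)) \<in> borel_measurable (borel \<Otimes>\<^sub>M M)" for i :: int
      using meas by measurable
    moreover have "(\<lambda>x. \<lfloor>real (Suc n) * fst x\<rfloor>) \<in> measurable (borel \<Otimes>\<^sub>M M) (count_space UNIV)"
      by measurable
    ultimately have "(\<lambda>x. f (of_int \<lfloor>real (Suc n) * fst x\<rfloor> / real (Suc n)) (snd x)) \<in> borel_measurable (borel \<Otimes>\<^sub>M M)"
      by (rule measurable_compose_countable)
    then show ?thesis by (simp add: d_def case_prod_unfold)
  qed
  have "(\<lambda>n. d n s) \<longlonglongrightarrow> s" for s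
  proof (rule tendsto_sandwich)
    have "(\<lambda>n. s - inverse (real (Suc n))) \<longlonglongrightarrow> s - 0"
      by (intro tendsto_intros LIMSEQ_inverse_real_of_nat)
    then show "(\<lambda>n. s - inverse (real (Suc n))) \<longlonglongrightarrow> s" by simp
    show "\<forall>\<^sub>F n in sequentially. s - inverse (real (Suc n)) \<le> d n s"
    proof (intro always_eventually allI)
      fix n
      have "real (Suc n) * s - 1 \<le> of_int \<lfloor>real (Suc n) * s\<rfloor>" by linarith
      then have "(real (Suc n) * s - 1) / real (Suc n) \<le> d n s"
        unfolding d_def by (rule divide_right_mono) simp
      then show "s - inverse (real (Suc n)) \<le> d n s"
        by (simp add: diff_divide_distrib inverse_eq_divide del: of_nat_Suc)
    qed
    show "\<forall>\<^sub>F n in sequentially. d n s \<le> s"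
    proof (intro always_eventually allI)
      fix n
      have "of_int \<lfloor>real (Suc n) * s\<rfloor> / real (Suc n) \<le> (real (Suc n) * s) / real (Suc n)"
        by (rule divide_right_mono) simp_all
      then show "d n s \<le> s" by (simp add: d_def del: of_nat_Suc)
    qed
  qed simp
  moreover fix x :: "real \<times> 'a" assume "x \<in> space (borel \<Otimes>\<^sub>M M)"
  ultimately show "(\<lambda>n. (\<lambda>(s, \<omega>). f (d n s) \<omega>) x) \<longlonglongrightarrow> (\<lambda>(s, \<omega>). f s \<omega>) x"
    using continuous_on_tendsto_compose[OF cont[of "snd x"], of "\<lambda>n. d n (fst x)" "fst x" sequentially]
    by (auto simp: space_pair_measure case_prod_unfold)
qed

lemma continuous_on_Ici:
  fixes f :: "real \<Rightarrow> real"
  assumes "\<And>T. continuous_on {0..T} f"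
  shows "continuous_on {0..} f"
  unfolding continuous_on_def
proof
  fix x :: real assume "x \<in> {0..}"
  then have "(f \<longlongrightarrow> f x) (at x within {0..x + 1})"
    using assms[of "x + 1"] by (auto simp: continuous_on_def)
  moreover have "at x within {0..x + 1} = at x within {0..}"
    by (rule at_within_nhd[of _ "{..<x + 1}"]) auto
  ultimately show "(f \<longlongrightarrow> f x) (at x within {0..})" by simp
qed

lemma LBINT_eq_integral:
  assumes "continuous_on {s..t} (f :: real \<Rightarrow> real)"
  shows "(LBINT x:{s..t}. f x) = integral {s..t} f"
  by (rule set_borel_integral_eq_integral(2)[OF borel_integrable_atLeastAtMost'[OF assms]])

context complete_brownian
begin

text \<open>For each \<open>s\<close> the inner integral \<open>J s\<close> is almost surely the pathwise one, with an exceptional set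
  that depends on \<open>s\<close>. Both are jointly measurable, so by Fubini's theorem almost every path has
  agreement for almost all \<open>s\<close>, and this suffices for the outer integral.\<close>
lemma driving_process_pathwise:
  assumes drive: "driving_process Q W p q Z"
    and h: "C1_on (\<lambda>x. exp ((p + q) * x) * l_fun p q x) h' {0..}"
  shows "AE \<omega> in Q. \<forall>t\<ge>0. Z t \<omega> = W t \<omega> - integral {0..t}
    (\<lambda>s. p * exp (- (p + q) * s) * wiener (\<lambda>x. exp ((p + q) * x) * l_fun p q x) h' 0 s \<omega>)"
proof -
  let ?h = "\<lambda>x. exp ((p + q) * x) * l_fun p q x"
  define k where "k s = p * exp (- (p + q) * s)" for s
  have hT: "C1_on ?h h' {0..T}" for T by (rule C1_on_subset[OF h]) auto
  obtain J where J: "(\<lambda>(s, \<omega>). J s \<omega>) \<in> borel_measurable (restrict_space borel {0..} \<Otimes>\<^sub>M Q)"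
    and ito: "\<And>s. 0 \<le> s \<Longrightarrow> is_ito_integral Q F W s
           (\<lambda>\<tau> \<omega>. p * exp (- (p + q) * (s - \<tau>)) * l_fun p q \<tau>) (J s)"
    and Z: "AE \<omega> in Q. \<forall>t\<ge>0. Z t \<omega> = W t \<omega> - (LBINT s:{0..t}. J s \<omega>)"
    using drive unfolding driving_process_def by blast
  have JW: "AE \<omega> in Q. J s \<omega> = k s * wiener ?h h' 0 s \<omega>" if s: "0 \<le> s" for s
  proof -
    have eq: "p * exp (- (p + q) * (s - \<tau>)) * l_fun p q \<tau> = k s * ?h \<tau>" for \<tau>
      by (simp add: k_def exp_add[symmetric] algebra_simps)
    have "AE \<omega> in Q. J s \<omega> = wiener (\<lambda>x. k s * ?h x) (\<lambda>x. k s * h' x) 0 s \<omega>"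
      using ito[OF s] unfolding eq by (rule ito_integral_deterministic[OF _ C1_on_cmult[OF hT] s])
    then show ?thesis unfolding wiener_def parts_integral_cmult .
  qed
  define \<Omega>0 where "\<Omega>0 = {\<omega> \<in> space Q. continuous_on {0..} (\<lambda>t. W t \<omega>)}"
  \<comment> \<open>Discontinuous paths are replaced by zero and times are clipped to \<open>[0, \<infinity>)\<close>, which makes \<open>U\<close>
    continuous on the whole line for every outcome, hence jointly measurable.\<close>
  define V where "V s \<omega> = (if \<omega> \<in> \<Omega>0 then W (max 0 s) \<omega> else 0)" for s \<omega>
  define U where "U s \<omega> = parts_integral ?h h' (\<lambda>x. V x \<omega>) 0 (max 0 s)" for s \<omega>
  have AE0: "AE \<omega> in Q. \<omega> \<in> \<Omega>0" using AE_continuous_W AE_space by eventually_elim (simp add: \<Omega>0_def)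
  have UW: "U s \<omega> = wiener ?h h' 0 s \<omega>" if "\<omega> \<in> \<Omega>0" "0 \<le> s" for s \<omega>
    unfolding U_def wiener_def using that by (simp add: V_def max_absorb2) (rule parts_integral_cong; simp add: V_def)
  have contV: "continuous_on {0..T} (\<lambda>x. V x \<omega>)" for \<omega> T
  proof (cases "\<omega> \<in> \<Omega>0")
    case True
    then have "continuous_on {0..T} (\<lambda>x. W x \<omega>)"
      by (auto simp: \<Omega>0_def intro: continuous_on_subset)
    then show ?thesis using True by (simp add: V_def cong: continuous_on_cong_simp)
  qed (simp add: V_def)
  have "(\<lambda>(s, \<omega>). U s \<omega>) \<in> borel_measurable (borel \<Otimes>\<^sub>M Q)"
  proof (rule borel_measurable_continuous_process)
    fix s :: real
    have "wiener ?h h' 0 (max 0 s) \<in> borel_measurable Q"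
      by (rule measurable_F[OF measurable_F_wiener[OF hT]]) auto
    moreover have "AE \<omega> in Q. wiener ?h h' 0 (max 0 s) \<omega> = U s \<omega>"
      using AE0 by eventually_elim (simp add: UW[symmetric], simp add: U_def)
    ultimately show "U s \<in> borel_measurable Q" by (rule measurable_Q_AE_eq)
  next
    fix \<omega>
    have "continuous_on {0..} (\<lambda>s. parts_integral ?h h' (\<lambda>x. V x \<omega>) 0 s)"
      by (rule continuous_on_Ici[OF continuous_on_parts_integral[OF hT contV]])
    then show "continuous_on UNIV (\<lambda>s. U s \<omega>)" unfolding U_def
      by (rule continuous_on_compose2) (auto intro!: continuous_intros)
  qed
  then have Um[measurable]: "(\<lambda>x. U (fst x) (snd x)) \<in> borel_measurable (lborel \<Otimes>\<^sub>M Q)"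
    by (simp add: case_prod_unfold)
  have "(\<lambda>x. (max (0::real) (fst x), snd x)) \<in> measurable (borel \<Otimes>\<^sub>M Q) (restrict_space borel {0..} \<Otimes>\<^sub>M Q)"
  proof (intro measurable_Pair measurable_restrict_space2)
    show "(\<lambda>x. max (0::real) (fst x)) \<in> borel_measurable (borel \<Otimes>\<^sub>M Q)"
      by (intro borel_measurable_max borel_measurable_const measurable_fst)
  qed auto
  from measurable_compose[OF this J]
  have Jm[measurable]: "(\<lambda>x. J (max 0 (fst x)) (snd x)) \<in> borel_measurable (lborel \<Otimes>\<^sub>M Q)" by simp
  have km[measurable]: "k \<in> borel_measurable borel" unfolding k_def by measurable
  interpret pair_sigma_finite lborel Q
    by unfold_locales
  have "AE s in lborel. AE \<omega> in Q. J (max 0 s) \<omega> = k (max 0 s) * U s \<omega>"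
  proof (rule AE_I2)
    fix s :: real
    show "AE \<omega> in Q. J (max 0 s) \<omega> = k (max 0 s) * U s \<omega>"
      using JW[of "max 0 s", OF max.cobounded1] AE0
      by eventually_elim (simp add: UW[symmetric], simp add: U_def)
  qed
  moreover have "{x \<in> space (lborel \<Otimes>\<^sub>M Q). J (max 0 (fst x)) (snd x) = k (max 0 (fst x)) * U (fst x) (snd x)}
      \<in> sets (lborel \<Otimes>\<^sub>M Q)"
    by measurable
  ultimately have "AE \<omega> in Q. AE s in lborel. J (max 0 s) \<omega> = k (max 0 s) * U s \<omega>"
    using AE_commute[of "\<lambda>s \<omega>. J (max 0 s) \<omega> = k (max 0 s) * U s \<omega>"] by blast
  with Z AE0 AE_space show ?thesis
  proof eventually_elim
    case (elim \<omega>)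
    show ?case
    proof (intro allI impI)
      fix t :: real assume t: "0 \<le> t"
      have [measurable]: "(\<lambda>s. J (max 0 s) \<omega>) \<in> borel_measurable lborel" "(\<lambda>s. U s \<omega>) \<in> borel_measurable lborel"
        using measurable_compose[OF measurable_Pair2'[OF elim(3), of lborel] Jm]
          measurable_compose[OF measurable_Pair2'[OF elim(3), of lborel] Um] by simp_all
      have "(LBINT s:{0..t}. J s \<omega>) = (LBINT s:{0..t}. J (max 0 s) \<omega>)"
        by (intro set_lebesgue_integral_cong) auto
      also have "\<dots> = (LBINT s:{0..t}. k (max 0 s) * U s \<omega>)"
        using elim(4) by (intro set_lebesgue_integral_cong_AE) auto
      also have "\<dots> = (LBINT s:{0..t}. k s * wiener ?h h' 0 s \<omega>)"
        using elim(2) by (intro set_lebesgue_integral_cong) (auto simp: UW)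
      also have "\<dots> = integral {0..t} (\<lambda>s. k s * wiener ?h h' 0 s \<omega>)"
      proof (rule LBINT_eq_integral)
        have "continuous_on {0..t} (\<lambda>x. W x \<omega>)" using elim(2) by (auto simp: \<Omega>0_def intro: continuous_on_subset)
        then show "continuous_on {0..t} (\<lambda>s. k s * wiener ?h h' 0 s \<omega>)"
          unfolding k_def wiener_def by (intro continuous_intros continuous_on_parts_integral hT)
      qed
      finally show "Z t \<omega> = W t \<omega> - integral {0..t} (\<lambda>s. p * exp (- (p + q) * s) * wiener ?h h' 0 s \<omega>)"
        using elim(1) t by (simp add: k_def)
    qed
  qed
qed

end

section \<open>The deterministic coefficients\<close>

lemma noise_denominator_pos:
  fixes p q x :: real
  assumes "0 < q" "- q < p" "0 \<le> x"
  shows "0 < (p + 2 * q)\<^sup>2 * exp (2 * q * x) - p\<^sup>2"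
proof -
  have "p\<^sup>2 < (p + 2 * q)\<^sup>2"
  proof -
    have "0 < 4 * q * (p + q)" using assms by simp
    then show ?thesis by (simp add: power2_eq_square algebra_simps)
  qed
  also have "\<dots> \<le> (p + 2 * q)\<^sup>2 * exp (2 * q * x)"
    using mult_left_mono[of 1 "exp (2 * q * x)" "(p + 2 * q)\<^sup>2"] assms by simp
  finally show ?thesis by simp
qed

text \<open>The kernel has a pole at a negative time when \<open>p \<noteq> 0\<close>, whence the restriction to \<open>{0..}\<close>.\<close>
lemma ex_C1_on_noise_kernel:
  assumes pq: "0 < q" "- q < p"
  shows "\<exists>h'. C1_on (\<lambda>x. exp ((p + q) * x) * l_fun p q x) h' {0..}"
proof -
  let ?E = "\<lambda>x. (p + 2 * q)\<^sup>2 * exp (2 * q * x) - p\<^sup>2"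
  define l' where "l' x = 2 * q * p * ((p + 2 * q)\<^sup>2 * (2 * q * exp (2 * q * x))) / (?E x)\<^sup>2" for x
  have nz: "?E x \<noteq> 0" if "0 \<le> x" for x using noise_denominator_pos[OF pq that] by simp
  have "C1_on (l_fun p q) l' {0..}"
    unfolding C1_on_def
  proof (intro conjI ballI)
    fix x :: real assume "x \<in> {0..}"
    then show "(l_fun p q has_real_derivative l' x) (at x within {0..})"
      unfolding l_fun_def[abs_def] using nz[of x]
      by (auto intro!: derivative_eq_intros simp: l'_def power2_eq_square)
  next
    show "continuous_on {0..} l'" unfolding l'_def using nz by (intro continuous_intros) auto
  qed
  moreover have "C1_on (\<lambda>x. exp ((p + q) * x)) (\<lambda>x. (p + q) * exp ((p + q) * x)) {0..}"
    unfolding C1_on_def by (auto intro!: derivative_eq_intros continuous_intros)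
  ultimately show ?thesis using C1_on_mult[of "\<lambda>x. exp ((p + q) * x)" _ "{0..}" "l_fun p q" l'] by blast
qed

text \<open>Reflecting the variable in the convolution moves the dependence on \<open>t\<close> out of the integrand, so
  that the derivative of \<open>m_fun\<close> can be read off.\<close>
lemma m_fun_eq:
  assumes "0 \<le> t"
  shows "m_fun p q b t = exp (- (p + q) * t) * integral {0..t} (\<lambda>s. p * exp ((p + q) * s) * (1 - exp (- b * s)))"
proof -
  have "m_fun p q b t = (LBINT s:{0..t}. exp (- (p + q) * t) * (p * exp ((p + q) * s) * (1 - exp (- b * s))))"
    unfolding m_fun_def set_lebesgue_integral_def
    by (subst lborel_integral_real_affine[where c="-1" and t=t])
       (auto intro!: Bochner_Integration.integral_cong simp: indicator_def exp_add[symmetric] algebra_simps)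
  also have "\<dots> = integral {0..t} (\<lambda>s. exp (- (p + q) * t) * (p * exp ((p + q) * s) * (1 - exp (- b * s))))"
    by (intro LBINT_eq_integral continuous_intros)
  finally show ?thesis by simp
qed

lemma m_fun_0 [simp]: "m_fun p q b 0 = 0"
  using m_fun_eq[of 0 p q b] by simp

lemma C1_on_m_fun:
  "C1_on (m_fun p q b) (\<lambda>x. p * (1 - exp (- b * x)) - (p + q) * m_fun p q b x) {0..T}"
proof -
  let ?f = "\<lambda>s. p * exp ((p + q) * s) * (1 - exp (- b * s))"
  have e: "C1_on (\<lambda>x. exp (- (p + q) * x)) (\<lambda>x. - (p + q) * exp (- (p + q) * x)) {0..T}"
    unfolding C1_on_def by (auto intro!: derivative_eq_intros continuous_intros)
  have "continuous_on {0..T} ?f" by (intro continuous_intros)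
  from C1_on_mult[OF e C1_on_integral[OF this]] show ?thesis
  proof (rule C1_on_cong)
    fix x assume "x \<in> {0..T}"
    then have m: "m_fun p q b x = exp (- (p + q) * x) * integral {0..x} ?f" by (intro m_fun_eq) auto
    then show "exp (- (p + q) * x) * integral {0..x} ?f = m_fun p q b x" by simp
    have "exp (- (p + q) * x) * exp ((p + q) * x) = 1" by (simp add: exp_add[symmetric] algebra_simps)
    then have "exp (- (p + q) * x) * ?f x = p * (1 - exp (- b * x))" by (simp add: ac_simps)
    then show "- (p + q) * exp (- (p + q) * x) * integral {0..x} ?f + exp (- (p + q) * x) * ?f x
      = p * (1 - exp (- b * x)) - (p + q) * m_fun p q b x"
      by (simp only: m)
  qed
qed

lemma C1_on_C_fun:
  assumes "b \<noteq> 0"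
  shows "C1_on (\<lambda>x. C_fun b x T) (\<lambda>x. - exp (- b * (T - x))) S"
  unfolding C1_on_def C_fun_def using assms
  by (auto intro!: derivative_eq_intros continuous_intros)

text \<open>The linear differential equation of \<open>m_fun\<close> cancels the derivative of the exponential factor and
  leaves the source term \<open>p * (1 - exp (- b * (T - x)))\<close>.\<close>
lemma C1_on_D_kernel:
  assumes "b \<noteq> 0" "0 \<le> t"
  shows "C1_on (\<lambda>x. exp (- (p + q) * x) * m_fun p q b (T - x) / b)
    (\<lambda>x. - (C_fun b x T * (p * exp (- (p + q) * x)))) {t..T}"
proof -
  have e: "C1_on (\<lambda>x. exp (- (p + q) * x)) (\<lambda>x. - (p + q) * exp (- (p + q) * x)) {t..T}"
    unfolding C1_on_def by (auto intro!: derivative_eq_intros continuous_intros)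
  have "C1_on (\<lambda>x. exp (- (p + q) * x) * m_fun p q b (T - x))
     (\<lambda>x. - (p + q) * exp (- (p + q) * x) * m_fun p q b (T - x)
       + exp (- (p + q) * x) * - (p * (1 - exp (- b * (T - x))) - (p + q) * m_fun p q b (T - x))) {t..T}"
    by (rule C1_on_mult[OF e C1_on_reflect[OF C1_on_m_fun \<open>0 \<le> t\<close>]])
  from C1_on_cmult[OF this, of "1 / b"] show ?thesis
    by (rule C1_on_cong) (use assms in \<open>simp_all add: C_fun_def field_simps\<close>)
qed

lemma integral_C_fun:
  assumes "b \<noteq> 0" "t \<le> T"
  shows "integral {t..T} (\<lambda>x. C_fun b x T) = (T - t - C_fun b t T) / b"
proof -
  have "C1_on (\<lambda>x. (x + C_fun b x T) / b) (\<lambda>x. C_fun b x T) {t..T}"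
    unfolding C1_on_def C_fun_def using assms
    by (auto intro!: derivative_eq_intros continuous_intros simp: field_simps)
  from C1_on_FTC[OF this assms(2)]
  have "integral {t..T} (\<lambda>x. C_fun b x T) = (T + C_fun b T T) / b - (t + C_fun b t T) / b"
    by (rule integral_unique)
  then show ?thesis by (simp add: C_fun_def[of b T T] diff_divide_distrib add_divide_distrib)
qed

text \<open>After multiplication by \<open>b\<^sup>2\<close> the integrand becomes
  \<open>(1 - exp (- b * (T - x)) - m_fun p q b (T - x) * l_fun p q x)\<^sup>2\<close>. With
  \<open>l_fun p q x = 1 - p * \<kappa> x\<close>, the part without \<open>\<kappa>\<close> is the integrand of \<open>A_fun\<close> at \<open>T - x\<close>. The rest is
  minus the derivative of \<open>(m_fun p q b (T - x))\<^sup>2 * \<kappa> x\<close>, because \<open>\<kappa>\<close> solves the Riccati equation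
  \<open>\<kappa>' = - 2 * q * \<kappa> - p\<^sup>2 * \<kappa>\<^sup>2\<close>.\<close>
lemma variance_identity:
  fixes p q b t T :: real
  assumes pq: "0 < q" "- q < p" and b: "0 < b" and t: "0 \<le> t" "t \<le> T"
  shows "b\<^sup>2 * integral {t..T} (\<lambda>x. (C_fun b x T
        - exp (- (p + q) * x) * m_fun p q b (T - x) / b * (exp ((p + q) * x) * l_fun p q x))\<^sup>2)
    = integral {0..T - t} (\<lambda>s. (m_fun p q b s + exp (- b * s) - 1)\<^sup>2)
      + 2 * q * (m_fun p q b (T - t))\<^sup>2 / ((p + 2 * q)\<^sup>2 * exp (2 * q * t) - p\<^sup>2)"
proof -
  let ?E = "\<lambda>x. (p + 2 * q)\<^sup>2 * exp (2 * q * x) - p\<^sup>2"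
  let ?m = "m_fun p q b"
  define \<kappa> where "\<kappa> x = 2 * q / ?E x" for x
  define f where "f s = (?m s + exp (- b * s) - 1)\<^sup>2" for s
  have nz: "?E x \<noteq> 0" if "0 \<le> x" for x using noise_denominator_pos[OF pq that] by simp
  have \<kappa>: "C1_on \<kappa> (\<lambda>x. - 2 * q * \<kappa> x - p\<^sup>2 * (\<kappa> x)\<^sup>2) {t..T}"
    unfolding C1_on_def
  proof (intro conjI ballI)
    fix x assume x: "x \<in> {t..T}"
    then have E: "?E x \<noteq> 0" using nz t by auto
    have "(\<kappa> has_real_derivative (- (2 * q) * ((p + 2 * q)\<^sup>2 * (2 * q * exp (2 * q * x))) / (?E x)\<^sup>2)) (at x within {t..T})"
      unfolding \<kappa>_def using E by (auto intro!: derivative_eq_intros simp: power2_eq_square)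
    also have "- (2 * q) * ((p + 2 * q)\<^sup>2 * (2 * q * exp (2 * q * x))) / (?E x)\<^sup>2
       = - (2 * q) * (2 * q * (?E x + p\<^sup>2)) / (?E x)\<^sup>2" by (simp add: algebra_simps)
    also have "\<dots> = - 2 * q * \<kappa> x - p\<^sup>2 * (\<kappa> x)\<^sup>2"
    proof -
      have "- (2 * q) * (2 * q * (e + P)) / e\<^sup>2 = - 2 * q * (2 * q / e) - P * (2 * q / e)\<^sup>2"
        if "e \<noteq> 0" for e P :: real
        using that by (simp add: field_simps power2_eq_square)
      from this[OF E] show ?thesis by (simp only: \<kappa>_def)
    qed
    finally show "(\<kappa> has_real_derivative - 2 * q * \<kappa> x - p\<^sup>2 * (\<kappa> x)\<^sup>2) (at x within {t..T})" .
  next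
    show "continuous_on {t..T} (\<lambda>x. - 2 * q * \<kappa> x - p\<^sup>2 * (\<kappa> x)\<^sup>2)"
      unfolding \<kappa>_def using nz t by (intro continuous_intros) auto
  qed
  have cf: "continuous_on {0..T} f"
    unfolding f_def using C1_on_continuous[OF C1_on_m_fun] by (intro continuous_intros)
  have K: "C1_on (\<lambda>x. integral {0..T - x} f) (\<lambda>x. - f (T - x)) {t..T}"
    by (rule C1_on_reflect[OF C1_on_integral[OF cf] t(1)])
  note m = C1_on_reflect[OF C1_on_m_fun t(1), of p q b T]
  define \<Theta> where "\<Theta> x = (-1) * integral {0..T - x} f - ?m (T - x) * ?m (T - x) * \<kappa> x" for x
  let ?\<phi> = "\<lambda>x. C_fun b x T - exp (- (p + q) * x) * ?m (T - x) / b * (exp ((p + q) * x) * l_fun p q x)"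
  have "C1_on \<Theta> (\<lambda>x. b\<^sup>2 * (?\<phi> x)\<^sup>2) {t..T}"
    unfolding \<Theta>_def
  proof (rule C1_on_cong[OF C1_on_diff[OF C1_on_cmult[OF K, of "-1"] C1_on_mult[OF C1_on_mult[OF m m] \<kappa>]]])
    fix x assume x: "x \<in> {t..T}"
    have "exp (- (p + q) * x) * exp ((p + q) * x) = 1" by (simp add: exp_add[symmetric] algebra_simps)
    moreover have "exp (- (p + q) * x) * ?m (T - x) / b * (exp ((p + q) * x) * l_fun p q x)
        = (exp (- (p + q) * x) * exp ((p + q) * x)) * (?m (T - x) * l_fun p q x / b)" by simp
    ultimately have 1: "exp (- (p + q) * x) * ?m (T - x) / b * (exp ((p + q) * x) * l_fun p q x)
        = ?m (T - x) * l_fun p q x / b" by (simp only: mult_1)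
    have 2: "l_fun p q x = 1 - p * \<kappa> x" by (simp add: l_fun_def \<kappa>_def)
    have "b * ?\<phi> x = 1 - exp (- b * (T - x)) - ?m (T - x) * (1 - p * \<kappa> x)"
    proof -
      have "b * (c - d / b) = b * c - d" for c d using b by (simp add: right_diff_distrib)
      moreover have "b * C_fun b x T = 1 - exp (- b * (T - x))" using b by (simp add: C_fun_def)
      ultimately show ?thesis unfolding 1 by (simp only: 2)
    qed
    then have "b\<^sup>2 * (?\<phi> x)\<^sup>2 = (1 - exp (- b * (T - x)) - ?m (T - x) * (1 - p * \<kappa> x))\<^sup>2"
      by (metis power_mult_distrib)
    moreover have "(1 - e - M * (1 - p * \<kappa>'))\<^sup>2
      = (-1) * - (M + e - 1)\<^sup>2
        - ((- (p * (1 - e) - (p + q) * M) * M + M * - (p * (1 - e) - (p + q) * M)) * \<kappa>'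
           + M * M * (- 2 * q * \<kappa>' - p\<^sup>2 * \<kappa>'\<^sup>2))" for e M \<kappa>' :: real
      by (simp add: power2_eq_square algebra_simps)
    ultimately show "-1 * - f (T - x) - ((- (p * (1 - exp (- b * (T - x))) - (p + q) * ?m (T - x)) * ?m (T - x)
        + ?m (T - x) * - (p * (1 - exp (- b * (T - x))) - (p + q) * ?m (T - x))) * \<kappa> x
        + ?m (T - x) * ?m (T - x) * (- 2 * q * \<kappa> x - p\<^sup>2 * (\<kappa> x)\<^sup>2)) = b\<^sup>2 * (?\<phi> x)\<^sup>2"
      unfolding f_def by simp
  qed simp
  from C1_on_FTC[OF this t(2)]
  have "integral {t..T} (\<lambda>x. b\<^sup>2 * (?\<phi> x)\<^sup>2) = \<Theta> T - \<Theta> t" by (rule integral_unique)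
  then show ?thesis by (simp add: \<Theta>_def f_def[abs_def] \<kappa>_def power2_eq_square ac_simps)
qed

section \<open>The bond price\<close>

text \<open>The rate and \<open>u\<close> are as rough as the path, but \<open>y1 = r - \<sigma> * w\<close> and \<open>y2 = u - h * w\<close> are
  continuously differentiable, so the product rule applies to \<open>c * y1 - \<sigma> * G * y2\<close>. In its derivative
  \<open>u\<close> occurs with the coefficient \<open>- \<sigma> * (c * k + G')\<close>, which vanishes by the choice of \<open>G'\<close>; what
  remains besides the drift is \<open>- \<sigma> * (c - G * h)' * w\<close>, the integral part of the integration by parts
  for \<open>c - G * h\<close>.\<close>
lemma short_rate_functional:
  fixes w r u Z h h' c c' G k :: "real \<Rightarrow> real" and a b \<sigma> r0 :: real
  assumes w: "continuous_on {0..T} w" and r: "continuous_on {0..T} r"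
    and k: "continuous_on {0..T} k"
    and h: "C1_on h h' {0..T}"
    and u: "\<And>x. x \<in> {0..T} \<Longrightarrow> u x = parts_integral h h' w 0 x"
    and Z: "\<And>x. x \<in> {0..T} \<Longrightarrow> Z x = w x - integral {0..x} (\<lambda>y. k y * u y)"
    and req: "\<And>x. x \<in> {0..T} \<Longrightarrow> r x = r0 + integral {0..x} (\<lambda>y. a - b * r y) + \<sigma> * (Z x - Z 0)"
    and c: "C1_on c c' {s..t}" and G: "C1_on G (\<lambda>x. - (c x * k x)) {s..t}"
    and st: "0 \<le> s" "s \<le> t" "t \<le> T"
  shows "(c t * r t - \<sigma> * G t * u t) - (c s * r s - \<sigma> * G s * u s)
    = integral {s..t} (\<lambda>x. c' x * r x + c x * (a - b * r x))
      + \<sigma> * parts_integral (\<lambda>x. c x - G x * h x) (\<lambda>x. c' x - (- (c x * k x) * h x + G x * h' x)) w s t"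
proof -
  have sub: "{s..t} \<subseteq> {0..T}" using st by auto
  have hw: "continuous_on {0..T} (\<lambda>x. h' x * w x)"
    using w C1_on_continuous_deriv[OF h] by (intro continuous_intros)
  define y2 where "y2 x = - h 0 * w 0 - integral {0..x} (\<lambda>y. h' y * w y)" for x
  have y2: "C1_on y2 (\<lambda>x. 0 - h' x * w x) {0..T}"
    unfolding y2_def by (rule C1_on_diff[OF C1_on_const C1_on_integral[OF hw]])
  have uy: "u x = y2 x + h x * w x" if "x \<in> {0..T}" for x
    using u[OF that] by (simp add: y2_def parts_integral_def)
  have "continuous_on {0..T} (\<lambda>x. y2 x + h x * w x)"
    using C1_on_continuous[OF y2] C1_on_continuous[OF h] w by (intro continuous_intros)
  then have cu: "continuous_on {0..T} u" using uy by (simp cong: continuous_on_cong_simp)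
  have ku: "continuous_on {0..T} (\<lambda>x. k x * u x)" using k cu by (intro continuous_intros)
  have ar: "continuous_on {0..T} (\<lambda>x. a - b * r x)" using r by (intro continuous_intros)
  define y1 where "y1 x = (r0 - \<sigma> * Z 0) + (integral {0..x} (\<lambda>y. a - b * r y)
      - \<sigma> * integral {0..x} (\<lambda>y. k y * u y))" for x
  have y1: "C1_on y1 (\<lambda>x. 0 + ((a - b * r x) - \<sigma> * (k x * u x))) {0..T}"
    unfolding y1_def
    by (intro C1_on_add[OF C1_on_const] C1_on_diff C1_on_cmult C1_on_integral ar ku)
  have ry: "r x = y1 x + \<sigma> * w x" if "x \<in> {0..T}" for x
    using req[OF that] Z[OF that] by (simp add: y1_def algebra_simps)
  let ?D = "\<lambda>x. (c' x * y1 x + c x * (0 + ((a - b * r x) - \<sigma> * (k x * u x))))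
      - \<sigma> * (- (c x * k x) * y2 x + G x * (0 - h' x * w x))"
  let ?\<phi>' = "\<lambda>x. c' x - (- (c x * k x) * h x + G x * h' x)"
  have "C1_on (\<lambda>x. c x * y1 x - \<sigma> * (G x * y2 x)) ?D {s..t}"
    by (intro C1_on_diff C1_on_cmult C1_on_mult c G C1_on_subset[OF y1 sub] C1_on_subset[OF y2 sub])
  from C1_on_FTC[OF this st(2)]
  have "(?D has_integral (c t * y1 t - \<sigma> * (G t * y2 t)) - (c s * y1 s - \<sigma> * (G s * y2 s))) {s..t}" .
  moreover have "?D x = (c' x * r x + c x * (a - b * r x)) - \<sigma> * (?\<phi>' x * w x)" if "x \<in> {s..t}" for x
  proof -
    have x: "x \<in> {0..T}" using that sub by auto
    have e1: "y1 x = r x - \<sigma> * w x" using ry[OF x] by simp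
    have e2: "u x = y2 x + h x * w x" by (rule uy[OF x])
    show ?thesis unfolding e1 e2 by (simp add: algebra_simps)
  qed
  ultimately have 1: "((\<lambda>x. (c' x * r x + c x * (a - b * r x)) - \<sigma> * (?\<phi>' x * w x)) has_integral
      (c t * y1 t - \<sigma> * (G t * y2 t)) - (c s * y1 s - \<sigma> * (G s * y2 s))) {s..t}"
    by (rule has_integral_eq[rotated])
  have cont: "continuous_on {s..t} r" "continuous_on {s..t} w" "continuous_on {s..t} k"
      "continuous_on {s..t} h" "continuous_on {s..t} h'" "continuous_on {s..t} c"
      "continuous_on {s..t} c'" "continuous_on {s..t} G"
    using continuous_on_subset[OF _ sub] r w k C1_on_continuous[OF h] C1_on_continuous_deriv[OF h]
      C1_on_continuous[OF c] C1_on_continuous_deriv[OF c] C1_on_continuous[OF G] by auto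
  have i1: "(\<lambda>x. c' x * r x + c x * (a - b * r x)) integrable_on {s..t}"
    using cont by (intro integrable_continuous_real continuous_intros)
  have i2: "(\<lambda>x. ?\<phi>' x * w x) integrable_on {s..t}"
    using cont by (intro integrable_continuous_real continuous_intros)
  have 2: "((\<lambda>x. (c' x * r x + c x * (a - b * r x)) - \<sigma> * (?\<phi>' x * w x)) has_integral
      integral {s..t} (\<lambda>x. c' x * r x + c x * (a - b * r x)) - \<sigma> * integral {s..t} (\<lambda>x. ?\<phi>' x * w x)) {s..t}"
    by (intro has_integral_diff has_integral_mult_right integrable_integral i1 i2)
  have s: "s \<in> {0..T}" and t: "t \<in> {0..T}" using st by auto
  show ?thesis
    using has_integral_unique[OF 1 2] ry[OF s] ry[OF t] uy[OF s] uy[OF t]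
    by (simp add: parts_integral_def algebra_simps)
qed

context complete_brownian
begin

lemma AE_short_rate_functional:
  assumes drive: "driving_process Q W p q Z"
    and h: "C1_on (\<lambda>x. exp ((p + q) * x) * l_fun p q x) h' {0..}"
    and rate: "short_rate_solution Q F Z a b \<sigma> r0 r"
    and c: "C1_on c c' {s..t}"
    and G: "C1_on G (\<lambda>x. - (c x * (p * exp (- (p + q) * x)))) {s..t}"
    and st: "0 \<le> s" "s \<le> t"
  defines "h \<equiv> \<lambda>x. exp ((p + q) * x) * l_fun p q x"
  shows "AE \<omega> in Q. (c t * r t \<omega> - \<sigma> * G t * wiener h h' 0 t \<omega>)
      - (c s * r s \<omega> - \<sigma> * G s * wiener h h' 0 s \<omega>)
    = integral {s..t} (\<lambda>x. c' x * r x \<omega> + c x * (a - b * r x \<omega>))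
      + \<sigma> * wiener (\<lambda>x. c x - G x * h x)
          (\<lambda>x. c' x - (- (c x * (p * exp (- (p + q) * x))) * h x + G x * h' x)) s t \<omega>"
proof -
  have hT: "C1_on h h' {0..t}" unfolding h_def by (rule C1_on_subset[OF h]) auto
  have cont: "AE \<omega> in Q. continuous_on {0..} (\<lambda>t. r t \<omega>)"
    and r0: "AE \<omega> in Q. r 0 \<omega> = r0"
    and req: "AE \<omega> in Q. \<forall>t\<ge>0.
        r t \<omega> = r 0 \<omega> + (LBINT s:{0..t}. a - b * r s \<omega>) + \<sigma> * (Z t \<omega> - Z 0 \<omega>)"
    using rate by (auto simp: short_rate_solution_def)
  from AE_continuous_W driving_process_pathwise[OF drive h] cont r0 req
  show ?thesis
  proof eventually_elim
    case (elim \<omega>)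
    have rc: "continuous_on {0..x} (\<lambda>x. r x \<omega>)" for x
      by (rule continuous_on_subset[OF elim(3)]) auto
    have req': "r x \<omega> = r0 + integral {0..x} (\<lambda>y. a - b * r y \<omega>) + \<sigma> * (Z x \<omega> - Z 0 \<omega>)" if "x \<in> {0..t}" for x
    proof -
      have "(LBINT s:{0..x}. a - b * r s \<omega>) = integral {0..x} (\<lambda>y. a - b * r y \<omega>)"
        using rc[of x] by (intro LBINT_eq_integral continuous_intros)
      moreover have "0 \<le> x" using that by simp
      ultimately show ?thesis using elim(5)[rule_format, of x] elim(4) by simp
    qed
    have wc: "continuous_on {0..t} (\<lambda>x. W x \<omega>)" by (rule continuous_on_subset[OF elim(1)]) auto
    have kc: "continuous_on {0..t} (\<lambda>x. p * exp (- (p + q) * x))" by (intro continuous_intros)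
    have Z: "Z x \<omega> = W x \<omega> - integral {0..x} (\<lambda>y. p * exp (- (p + q) * y) * parts_integral h h' (\<lambda>x. W x \<omega>) 0 y)"
      if "x \<in> {0..t}" for x
      using elim(2) that by (simp add: wiener_def h_def)
    show ?case unfolding wiener_def
      by (rule short_rate_functional[OF wc rc kc hT refl Z req' c G st order_refl])
  qed
qed

text \<open>Up to time \<open>t\<close> the weight \<open>c x = \<alpha> * exp (- b * (t - x))\<close> solves \<open>c' = b * c\<close>, which eliminates the
  rate from the drift as well. The exponent is then a constant plus a Gaussian variable.\<close>
lemma integrable_affine_functional:
  assumes drive: "driving_process Q W p q Z"
    and h: "C1_on (\<lambda>x. exp ((p + q) * x) * l_fun p q x) h' {0..}"
    and rate: "short_rate_solution Q F Z a b \<sigma> r0 r" and "0 \<le> t"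
  defines "h \<equiv> \<lambda>x. exp ((p + q) * x) * l_fun p q x"
  shows "integrable Q (\<lambda>\<omega>. exp (- (\<alpha> * r t \<omega> - \<sigma> * \<gamma> * wiener h h' 0 t \<omega>)))"
proof -
  define c where "c x = \<alpha> * exp (- b * (t - x))" for x
  define k where "k x = c x * (p * exp (- (p + q) * x))" for x
  \<comment> \<open>The antiderivative of \<open>- k\<close> with value \<open>\<gamma>\<close> at time \<open>t\<close>; its value at \<open>0\<close> does not contribute,
    since the integral of \<open>h\<close> over \<open>[0, 0]\<close> vanishes.\<close>
  define G where "G x = (\<gamma> + integral {0..t} k) - integral {0..x} k" for x
  have c: "C1_on c (\<lambda>x. b * c x) {0..t}"
    unfolding C1_on_def c_def by (auto intro!: derivative_eq_intros continuous_intros)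
  have "continuous_on {0..t} k" unfolding k_def c_def by (intro continuous_intros)
  then have G: "C1_on G (\<lambda>x. - k x) {0..t}"
    using C1_on_diff[OF C1_on_const C1_on_integral] unfolding G_def by fastforce
  have hT: "C1_on h h' {0..t}" unfolding h_def by (rule C1_on_subset[OF h]) auto
  define \<psi> where "\<psi> x = c x - G x * h x" for x
  define \<psi>' where "\<psi>' x = b * c x - (- k x * h x + G x * h' x)" for x
  have \<psi>: "C1_on \<psi> \<psi>' {0..t}"
    unfolding \<psi>_def \<psi>'_def by (rule C1_on_diff[OF c C1_on_mult[OF G hT]])
  define K where "K = c 0 * r0 + a * integral {0..t} c"
  have r0: "AE \<omega> in Q. r 0 \<omega> = r0" and rm: "r t \<in> borel_measurable (F t)"
    using rate \<open>0 \<le> t\<close> by (auto simp: short_rate_solution_def)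
  have eq: "AE \<omega> in Q. exp (- K) * exp (- \<sigma> * wiener \<psi> \<psi>' 0 t \<omega>)
      = exp (- (\<alpha> * r t \<omega> - \<sigma> * \<gamma> * wiener h h' 0 t \<omega>))"
    using AE_short_rate_functional[OF drive h rate c G[unfolded k_def] order_refl \<open>0 \<le> t\<close>] r0
  proof eventually_elim
    case (elim \<omega>)
    have "integral {0..t} (\<lambda>x. b * c x * r x \<omega> + c x * (a - b * r x \<omega>)) = a * integral {0..t} c"
    proof -
      have "b * c x * r x \<omega> + c x * (a - b * r x \<omega>) = a * c x" for x by (simp add: algebra_simps)
      then show ?thesis by simp
    qed
    moreover have "wiener h h' 0 0 \<omega> = 0" by (simp add: wiener_def)
    ultimately have "\<alpha> * r t \<omega> - \<sigma> * \<gamma> * wiener h h' 0 t \<omega> = K + \<sigma> * wiener \<psi> \<psi>' 0 t \<omega>"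
      using elim unfolding h_def \<psi>_def[abs_def] \<psi>'_def[abs_def] k_def
      by (simp add: K_def G_def c_def)
    then show ?case by (simp add: exp_add[symmetric])
  qed
  have "integrable Q (\<lambda>\<omega>. exp (- K) * exp (- \<sigma> * wiener \<psi> \<psi>' 0 t \<omega>))"
    using integrable_exp_wiener[OF \<psi> order_refl \<open>0 \<le> t\<close>, of "- \<sigma>"] by simp
  moreover have "(\<lambda>\<omega>. exp (- (\<alpha> * r t \<omega> - \<sigma> * \<gamma> * wiener h h' 0 t \<omega>))) \<in> borel_measurable Q"
    using measurable_F[OF rm] measurable_F[OF measurable_F_wiener[OF hT order_refl \<open>0 \<le> t\<close>]] by measurable
  ultimately show ?thesis
    using integrable_cong_AE_imp[OF _ _ eq] by auto
qed

text \<open>The weight \<open>C_fun b x T\<close> satisfies \<open>c' - b * c = - 1\<close>, so the drift produces minus the integrated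
  rate. This writes the discount factor as a variable \<open>Y\<close> known at time \<open>t\<close> times the exponential of a
  Gaussian variable that is independent of \<open>F t\<close>.\<close>
lemma bond_price_formula:
  assumes pq: "0 < q" "- q < p" and b: "0 < b"
    and drive: "driving_process Q W p q Z"
    and rate: "short_rate_solution Q F Z a b \<sigma> r0 r"
    and u: "is_ito_integral Q F W t (\<lambda>s \<omega>. exp ((p + q) * s) * l_fun p q s) (u t)"
    and t: "0 \<le> t" "t \<le> T"
  shows "integrable Q (discount r t T)"
    and "AE \<omega> in Q. bond_price Q F r t T \<omega> = F_fun p q a b \<sigma> t (r t \<omega>) (u t \<omega>) T"
proof -
  define h where "h = (\<lambda>x. exp ((p + q) * x) * l_fun p q x)"
  obtain h' where h': "C1_on (\<lambda>x. exp ((p + q) * x) * l_fun p q x) h' {0..}"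
    using ex_C1_on_noise_kernel[OF pq] by blast
  have hT: "C1_on h h' {s..x}" if "0 \<le> s" for s x
    unfolding h_def by (rule C1_on_subset[OF h']) (use that in auto)
  define G where "G x = exp (- (p + q) * x) * m_fun p q b (T - x) / b" for x
  define G' where "G' x = - (C_fun b x T * (p * exp (- (p + q) * x)))" for x
  have G: "C1_on G G' {t..T}"
    unfolding G_def G'_def using b t by (intro C1_on_D_kernel) auto
  have C: "C1_on (\<lambda>x. C_fun b x T) (\<lambda>x. - exp (- b * (T - x))) {t..T}"
    using b by (intro C1_on_C_fun) auto
  define \<phi> where "\<phi> x = C_fun b x T - G x * h x" for x
  define \<phi>' where "\<phi>' x = - exp (- b * (T - x)) - (G' x * h x + G x * h' x)" for x
  have \<phi>: "C1_on \<phi> \<phi>' {t..T}"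
    unfolding \<phi>_def \<phi>'_def by (rule C1_on_diff[OF C C1_on_mult[OF G hT[OF t(1)]]])
  define v where "v = integral {t..T} (\<lambda>x. (\<phi> x)\<^sup>2)"
  have D: "D_fun p q b \<sigma> t T = \<sigma> * G t" by (simp add: D_fun_def G_def)
  have v: "b\<^sup>2 * v = integral {0..T - t} (\<lambda>s. (m_fun p q b s + exp (- b * s) - 1)\<^sup>2)
      + 2 * q * (m_fun p q b (T - t))\<^sup>2 / ((p + 2 * q)\<^sup>2 * exp (2 * q * t) - p\<^sup>2)"
    unfolding v_def \<phi>_def G_def h_def by (rule variance_identity[OF pq b t])
  have A: "- A_fun p q a b \<sigma> t T = - (a / b * (T - t - C_fun b t T)) + \<sigma>\<^sup>2 * v / 2"
  proof -
    have "(LBINT s:{0..T - t}. (m_fun p q b s + exp (- b * s) - 1)\<^sup>2)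
        = integral {0..T - t} (\<lambda>s. (m_fun p q b s + exp (- b * s) - 1)\<^sup>2)"
      using C1_on_continuous[OF C1_on_m_fun] by (intro LBINT_eq_integral continuous_intros)
    then have "A_fun p q a b \<sigma> t T = a / b * (T - t - C_fun b t T) - \<sigma>\<^sup>2 / (2 * b\<^sup>2) * (b\<^sup>2 * v)"
      unfolding A_fun_def v by (simp add: algebra_simps)
    then show ?thesis using b by simp
  qed
  have rm[measurable]: "r t \<in> borel_measurable (F t)"
    and rc: "AE \<omega> in Q. continuous_on {0..} (\<lambda>t. r t \<omega>)"
    using rate t by (auto simp: short_rate_solution_def)
  have uw: "AE \<omega> in Q. wiener h h' 0 t \<omega> = u t \<omega>"
  proof -
    have "is_ito_integral Q F W t (\<lambda>s \<omega>. h s) (u t)" using u by (simp add: h_def)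
    from ito_integral_deterministic[OF this hT[OF order_refl] t(1)]
    show ?thesis by eventually_elim simp
  qed
  have um[measurable]: "u t \<in> borel_measurable (F t)"
    using measurable_F_wiener[OF hT[OF order_refl] order_refl t(1)] uw by (rule measurable_F_AE_eq)
  \<comment> \<open>The part of the discount factor that is known at time \<open>t\<close>.\<close>
  define Y where "Y \<omega> = exp (- (a / b * (T - t - C_fun b t T))) * exp (- (C_fun b t T * r t \<omega> - \<sigma> * G t * u t \<omega>))" for \<omega>
  have Ym: "Y \<in> borel_measurable (F t)" unfolding Y_def by measurable
  have Yi: "integrable Q Y"
  proof -
    have "integrable Q (\<lambda>\<omega>. exp (- (a / b * (T - t - C_fun b t T)))
        * exp (- (C_fun b t T * r t \<omega> - \<sigma> * G t * wiener h h' 0 t \<omega>)))"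
      unfolding h_def by (intro integrable_mult_right integrable_affine_functional[OF drive h' rate t(1)])
    then show ?thesis
    proof (rule integrable_cong_AE_imp)
      show "AE \<omega> in Q. exp (- (a / b * (T - t - C_fun b t T)))
        * exp (- (C_fun b t T * r t \<omega> - \<sigma> * G t * wiener h h' 0 t \<omega>)) = Y \<omega>"
        using uw by eventually_elim (simp add: Y_def)
    qed (rule measurable_F[OF Ym])
  qed
  have disc: "AE \<omega> in Q. Y \<omega> * exp (- \<sigma> * wiener \<phi> \<phi>' t T \<omega>) = discount r t T \<omega>"
    using AE_short_rate_functional[OF drive h' rate C G[unfolded G'_def] t] rc uw
  proof eventually_elim
    case (elim \<omega>)
    have c: "continuous_on {t..T} (\<lambda>x. r x \<omega>)"
      by (rule continuous_on_subset[OF elim(2)]) (use t in auto)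
    have "integral {t..T} (\<lambda>x. - exp (- b * (T - x)) * r x \<omega> + C_fun b x T * (a - b * r x \<omega>))
        = integral {t..T} (\<lambda>x. a * C_fun b x T - r x \<omega>)"
    proof -
      have "b * C_fun b x T = 1 - exp (- b * (T - x))" for x using b by (simp add: C_fun_def)
      then have "- exp (- b * (T - x)) = b * C_fun b x T - 1" for x by simp
      then show ?thesis by (intro integral_cong) (simp only:, simp add: algebra_simps)
    qed
    also have "\<dots> = a * ((T - t - C_fun b t T) / b) - integral {t..T} (\<lambda>x. r x \<omega>)"
      using b t C1_on_continuous[OF C] c
      by (subst integral_diff) (auto simp: integral_C_fun intro!: integrable_continuous_real continuous_intros)
    finally have "- integral {t..T} (\<lambda>x. r x \<omega>) = - (a / b * (T - t - C_fun b t T))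
       - (C_fun b t T * r t \<omega> - \<sigma> * G t * u t \<omega>) - \<sigma> * wiener \<phi> \<phi>' t T \<omega>"
      using elim(1) elim(3) unfolding \<phi>_def[abs_def] \<phi>'_def[abs_def] G'_def h_def
      by (simp add: C_fun_def[of b T T] G_def[of T])
    moreover have "(LBINT s:{t..T}. r s \<omega>) = integral {t..T} (\<lambda>x. r x \<omega>)"
      by (rule LBINT_eq_integral[OF c])
    ultimately show ?case by (simp add: discount_def Y_def exp_add[symmetric])
  qed
  have Yexp: "integrable Q (\<lambda>\<omega>. Y \<omega> * exp (- \<sigma> * wiener \<phi> \<phi>' t T \<omega>))"
    by (rule integrable_times_exp_wiener[OF \<phi> t Ym Yi])
  have dm: "discount r t T \<in> borel_measurable Q"
    using borel_measurable_integrable[OF Yexp] disc by (rule measurable_Q_AE_eq)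
  show di: "integrable Q (discount r t T)"
    using Yexp dm disc by (rule integrable_cong_AE_imp)
  define P where "P \<omega> = Y \<omega> * exp (\<sigma>\<^sup>2 * v / 2)" for \<omega>
  have P: "P \<omega> = F_fun p q a b \<sigma> t (r t \<omega>) (u t \<omega>) T" for \<omega>
    unfolding P_def Y_def F_fun_def A D by (simp add: exp_add[symmetric] algebra_simps)
  interpret finite_measure_subalgebra Q "F t"
    by unfold_locales (rule subalgebra_F)
  have "AE \<omega> in Q. real_cond_exp Q (F t) (discount r t T) \<omega> = P \<omega>"
  proof (rule real_cond_exp_charact)
    show "integrable Q P" unfolding P_def using Yi by simp
    show "P \<in> borel_measurable (F t)" unfolding P_def using Ym by measurable
    fix A assume A: "A \<in> sets (F t)"
    define YA where "YA \<omega> = indicator A \<omega> * Y \<omega>" for \<omega>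
    have YAm: "YA \<in> borel_measurable (F t)" unfolding YA_def using A Ym by measurable
    have YAi: "integrable Q YA" unfolding YA_def
      using integrable_mult_indicator[OF sets_F[OF A] Yi] by simp
    have "(LINT \<omega>:A|Q. discount r t T \<omega>) = (\<integral>\<omega>. YA \<omega> * exp (- \<sigma> * wiener \<phi> \<phi>' t T \<omega>) \<partial>Q)"
      unfolding set_lebesgue_integral_def
    proof (rule integral_cong_AE)
      show "(\<lambda>\<omega>. indicat_real A \<omega> *\<^sub>R discount r t T \<omega>) \<in> borel_measurable Q"
        using dm sets_F[OF A] by measurable
      show "(\<lambda>\<omega>. YA \<omega> * exp (- \<sigma> * wiener \<phi> \<phi>' t T \<omega>)) \<in> borel_measurable Q"
        using integrable_times_exp_wiener[OF \<phi> t YAm YAi] by (rule borel_measurable_integrable)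
      show "AE \<omega> in Q. indicat_real A \<omega> *\<^sub>R discount r t T \<omega> = YA \<omega> * exp (- \<sigma> * wiener \<phi> \<phi>' t T \<omega>)"
        using disc by eventually_elim (simp add: YA_def)
    qed
    also have "\<dots> = expectation YA * exp (\<sigma>\<^sup>2 * v / 2)"
      using expectation_times_exp_wiener[OF \<phi> t YAm YAi, of "- \<sigma>"] by (simp add: v_def)
    also have "\<dots> = (LINT \<omega>:A|Q. P \<omega>)"
      unfolding set_lebesgue_integral_def P_def YA_def by (simp add: mult.assoc[symmetric])
    finally show "(LINT \<omega>:A|Q. discount r t T \<omega>) = (LINT \<omega>:A|Q. P \<omega>)" .
  qed (rule di)
  then show "AE \<omega> in Q. bond_price Q F r t T \<omega> = F_fun p q a b \<sigma> t (r t \<omega>) (u t \<omega>) T"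
    by (simp add: bond_price_def P)
qed

end

theorem theorem5p2:
  fixes Q :: "'a measure"
    and W Z r u :: "real \<Rightarrow> 'a \<Rightarrow> real"
    and p q a b \<sigma> r0 t T :: real
  assumes "prob_space Q" and "complete_measure Q"
    and "brownian_motion Q W"
    and "0 < q" and "- q < p"
    and "driving_process Q W p q Z"
    and "0 < a" and "0 < b" and "0 < \<sigma>" and "0 \<le> r0"
    and "short_rate_solution Q (augmented_filtration Q W) Z a b \<sigma> r0 r"
    and "\<And>v. 0 \<le> v \<Longrightarrow>
      is_ito_integral Q (augmented_filtration Q W) W v (\<lambda>s \<omega>. exp ((p + q) * s) * l_fun p q s) (u v)"
    and "0 < T" and "0 \<le> t" and "t \<le> T"
  shows "integrable Q (discount r t T) \<and>
    (AE \<omega> in Q. bond_price Q (augmented_filtration Q W) r t T \<omega>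
       = F_fun p q a b \<sigma> t (r t \<omega>) (u t \<omega>) T)"
proof -
  interpret complete_brownian Q W
    using assms(1-3) by (intro complete_brownian.intro complete_brownian_axioms.intro)
  from bond_price_formula[where u=u and t=t, OF assms(4,5,8,6,11) assms(12)[OF assms(14)] assms(14,15)]
  show ?thesis by blast
qed

end
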